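(* Let $M$ and $N$ be matroids on a common countable edge set $E$, where each of $M$ and $N$ is either nearly finitary or nearly cofinitary. Then $\{M,N\}$ has the Intersection property, i.e. there exist a common independent set $I$ of $M$ and $N$ and a bipartition $E=E_M\cup E_N$ (with $E_M\cap E_N=\varnothing$) such that $I\cap E_M$ spans $E_M$ in $M$ and $I\cap E_N$ spans $E_N$ in $N$.
   Context: A (possibly infinite) matroid is a pair $M=(E,\mathcal I)$ with $\mathcal I\subseteq\mathcal P(E)$ such that: (1) $\varnothing\in\mathcal I$; (2) $\mathcal I$ is downward closed; (3) for all $I,J\in\mathcal I$ where $J$ is $\subseteq$-maximal in $\mathcal I$ but $I$ is not, there is $e\in J\setminus I$ with $I+e:=I\cup\{e\}\in\mathcal I$; (4) for every $X\subseteq E$, any $I\in\mathcal I\cap\mathcal P(X)$ can be extended to a $\subseteq$-maximal element of $\mathcal I\cap\mathcal P(X)$. Members of $\mathcal I$ are independent, maximal independent sets are bases, minimal dependent sets are circuits. A set $X$ spans $e$ in $M$ if $e\in X$ or there is a circuit $C\ni e$ with $C\setminus\{e\}\subseteq X$; $X$ spans a set if it spans each of its elements. The dual $M^*$ is the matroid on $E$ whose bases are the complements of the bases of $M$. A matroid is finitary if all of its circuits are finite. The finitarization of $M$ is the matroid on the same edge set whose circuits are exactly the finite circuits of $M$. $M$ is nearly finitary if every base of $M$ can be extended to a base of its finitarization by adding finitely many edges. $M$ is nearly cofinitary if $M^*$ is nearly finitary. *)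

theory Defs
  imports "HOL-Library.Countable_Set"
begin

definition maximal_in :: "'a set set \<Rightarrow> 'a set \<Rightarrow> bool" where
  "maximal_in F X \<longleftrightarrow> X \<in> F \<and> (\<forall>Y\<in>F. X \<subseteq> Y \<longrightarrow> Y = X)"

text \<open>A possibly infinite matroid with ground set \<open>E\<close> and family \<open>\<I>\<close> of independent sets.\<close>

locale matroid =
  fixes E :: "'a set" and \<I> :: "'a set set"
  assumes indep_subset_ground: "\<I> \<subseteq> Pow E"
    and empty_indep: "{} \<in> \<I>"
    and indep_subset: "J \<in> \<I> \<Longrightarrow> I \<subseteq> J \<Longrightarrow> I \<in> \<I>"
    and augment: "I \<in> \<I> \<Longrightarrow> maximal_in \<I> J \<Longrightarrow> \<not> maximal_in \<I> I
      \<Longrightarrow> \<exists>e\<in>J - I. insert e I \<in> \<I>"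
    and extend: "X \<subseteq> E \<Longrightarrow> I \<in> \<I> \<inter> Pow X
      \<Longrightarrow> \<exists>J. I \<subseteq> J \<and> maximal_in (\<I> \<inter> Pow X) J"

definition bases :: "'a set set \<Rightarrow> 'a set set" where
  "bases \<I> = {B. maximal_in \<I> B}"

definition circuits :: "'a set \<Rightarrow> 'a set set \<Rightarrow> 'a set set" where
  "circuits E \<I> = {C. C \<subseteq> E \<and> C \<notin> \<I> \<and> (\<forall>D. D \<subset> C \<longrightarrow> D \<in> \<I>)}"

definition spans :: "'a set \<Rightarrow> 'a set set \<Rightarrow> 'a set \<Rightarrow> 'a \<Rightarrow> bool" where
  "spans E \<I> X e \<longleftrightarrow> e \<in> X \<or> (\<exists>C\<in>circuits E \<I>. e \<in> C \<and> C - {e} \<subseteq> X)"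

definition spans_set :: "'a set \<Rightarrow> 'a set set \<Rightarrow> 'a set \<Rightarrow> 'a set \<Rightarrow> bool" where
  "spans_set E \<I> X Y \<longleftrightarrow> (\<forall>e\<in>Y. spans E \<I> X e)"

text \<open>
  The dual and the finitarization are determined by their bases and circuits, respectively; they
  are given here by the corresponding families of independent sets. The lemmas \<open>matroid_dual\<close>,
  \<open>bases_dual\<close>, \<open>dual_unique\<close> and \<open>matroid_finitarization\<close>, \<open>circuits_finitarization\<close>,
  \<open>finitarization_unique\<close> below show that these are the matroids meant.
\<close>

definition dual :: "'a set \<Rightarrow> 'a set set \<Rightarrow> 'a set set" where
  "dual E \<I> = {X. \<exists>B\<in>bases \<I>. X \<subseteq> E - B}"

definition finitarization :: "'a set \<Rightarrow> 'a set set \<Rightarrow> 'a set set" where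
  "finitarization E \<I> = {X. X \<subseteq> E \<and> \<not> (\<exists>C\<in>circuits E \<I>. finite C \<and> C \<subseteq> X)}"

definition nearly_finitary :: "'a set \<Rightarrow> 'a set set \<Rightarrow> bool" where
  "nearly_finitary E \<I> \<longleftrightarrow>
    (\<forall>B\<in>bases \<I>. \<exists>B'\<in>bases (finitarization E \<I>). B \<subseteq> B' \<and> finite (B' - B))"

definition nearly_cofinitary :: "'a set \<Rightarrow> 'a set set \<Rightarrow> bool" where
  "nearly_cofinitary E \<I> \<longleftrightarrow> nearly_finitary E (dual E \<I>)"

definition intersection_property :: "'a set \<Rightarrow> 'a set set \<Rightarrow> 'a set set \<Rightarrow> bool" where
  "intersection_property E \<M> \<N> \<longleftrightarrow>
    (\<exists>I E\<^sub>M E\<^sub>N. I \<in> \<M> \<inter> \<N> \<and> E = E\<^sub>M \<union> E\<^sub>N \<and> E\<^sub>M \<inter> E\<^sub>N = {} \<and>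
      spans_set E \<M> (I \<inter> E\<^sub>M) E\<^sub>M \<and> spans_set E \<N> (I \<inter> E\<^sub>N) E\<^sub>N)"

lemma maximal_inD: "maximal_in F X \<Longrightarrow> X \<in> F" "maximal_in F X \<Longrightarrow> Y \<in> F \<Longrightarrow> X \<subseteq> Y \<Longrightarrow> Y = X"
  unfolding maximal_in_def by auto

lemma maximal_in_eqI: "maximal_in F X \<Longrightarrow> insert e X \<in> F \<Longrightarrow> e \<in> X"
  unfolding maximal_in_def by (metis insertI1 subset_insertI)

lemma finite_dependent_contains_circuit:
  assumes "finite X" "X \<subseteq> E" "X \<notin> \<I>"
  shows "\<exists>C\<in>circuits E \<I>. C \<subseteq> X"
  using assms
proof (induction X rule: finite_psubset_induct)
  case (psubset X)
  show ?case
  proof (cases "\<forall>D. D \<subset> X \<longrightarrow> D \<in> \<I>")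
    case True
    with psubset.prems show ?thesis unfolding circuits_def by blast
  next
    case False
    then obtain D where "D \<subset> X" "D \<notin> \<I>" by blast
    with psubset.IH[of D] psubset.prems show ?thesis by blast
  qed
qed

context matroid
begin

lemma indep_in_ground: "I \<in> \<I> \<Longrightarrow> I \<subseteq> E"
  using indep_subset_ground by blast

lemma maximal_restrict_mono:
  assumes "maximal_in \<I> B" "B \<subseteq> X"
  shows "maximal_in (\<I> \<inter> Pow X) B"
  using assms unfolding maximal_in_def by blast

text \<open>Relatively maximal subsets of a set that contains a base are bases.\<close>

lemma maximal_in_spanning:
  assumes B: "maximal_in \<I> B" "B \<subseteq> X" and J: "maximal_in (\<I> \<inter> Pow X) J"
  shows "maximal_in \<I> J"
proof (rule ccontr)
  assume "\<not> maximal_in \<I> J"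
  with B J obtain e where "e \<in> B - J" "insert e J \<in> \<I>"
    using augment[of J B] maximal_inD(1)[OF J] by blast
  with B J maximal_in_eqI[OF J, of e] maximal_inD(1)[OF J] show False by blast
qed

lemma extend_spanning:
  assumes "maximal_in \<I> B" "B \<subseteq> X" "X \<subseteq> E" "I \<in> \<I>" "I \<subseteq> X"
  obtains J where "I \<subseteq> J" "J \<subseteq> X" "maximal_in \<I> J"
proof -
  obtain J where J: "I \<subseteq> J" "maximal_in (\<I> \<inter> Pow X) J"
    using extend[OF assms(3), of I] assms by blast
  show thesis
    using that[of J] J maximal_in_spanning[OF assms(1,2) J(2)] maximal_inD(1)[OF J(2)] by blast
qed

lemma extend_base:
  assumes "I \<in> \<I>"
  obtains B where "I \<subseteq> B" "maximal_in \<I> B"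
proof -
  have "\<I> \<inter> Pow E = \<I>" using indep_subset_ground by blast
  then show thesis using extend[of E I] assms that by auto
qed

lemma not_maximal_inI: "insert x I \<in> \<I> \<Longrightarrow> x \<notin> I \<Longrightarrow> \<not> maximal_in \<I> I"
  using maximal_in_eqI[of \<I> I x] by blast

lemma not_maximal_psubset: "J \<in> \<I> \<Longrightarrow> I \<subset> J \<Longrightarrow> \<not> maximal_in \<I> I"
  unfolding maximal_in_def by blast

text \<open>The exchange axiom for restrictions.\<close>

lemma augment_restrict:
  assumes X: "X \<subseteq> E" and J: "maximal_in (\<I> \<inter> Pow X) J"
    and I: "I \<in> \<I>" "I \<subseteq> X" and x: "x \<in> X" "x \<notin> I" "insert x I \<in> \<I>"
  shows "\<exists>e\<in>J - I. insert e I \<in> \<I>"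
proof (rule ccontr)
  assume no: "\<not> ?thesis"
  have Ji: "J \<in> \<I>" "J \<subseteq> X" using maximal_inD(1)[OF J] by auto
  obtain B where B: "J \<subseteq> B" "maximal_in \<I> B" using extend_base Ji by blast
  have Bi: "B \<in> \<I>" using B maximal_inD by blast
  have BX: "B \<inter> X = J"
    using maximal_inD(2)[OF J, of "B \<inter> X"] B Ji indep_subset[OF Bi, of "B \<inter> X"] by blast
  have BE: "B \<subseteq> E" using Bi indep_in_ground by blast
  text \<open>No base is of the form \<open>K \<union> B'\<close> with \<open>K \<subseteq> X\<close> and \<open>B'\<close> a proper subset of \<open>B - X\<close>.\<close>
  have key: "B - X \<subseteq> P" if P: "maximal_in \<I> P" "P \<subseteq> X \<union> (B - X)" for P
  proof (rule ccontr)
    assume n: "\<not> B - X \<subseteq> P"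
    let ?L = "J \<union> (P - X)"
    have ps: "?L \<subset> B" using B n P Ji by blast
    then have L: "?L \<in> \<I>" using indep_subset[OF Bi] by blast
    from augment[OF L P(1) not_maximal_psubset[OF Bi ps]]
    obtain e where e: "e \<in> P - ?L" "insert e ?L \<in> \<I>" by (elim bexE)
    have "insert e J \<in> \<I>" using indep_subset[OF e(2), of "insert e J"] by blast
    then have "e \<in> J" using maximal_in_eqI[OF J, of e] e Ji by blast
    with e show False by blast
  qed
  obtain K where K: "I \<subseteq> K" "maximal_in (\<I> \<inter> Pow (I \<union> (B - X))) K"
    using extend[of "I \<union> (B - X)" I] I X BE by blast
  have Ki: "K \<in> \<I>" "K \<subseteq> I \<union> (B - X)" using maximal_inD(1)[OF K(2)] by auto
  have Kb: "maximal_in \<I> K"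
  proof (rule ccontr)
    assume "\<not> maximal_in \<I> K"
    then obtain e where e: "e \<in> B - K" "insert e K \<in> \<I>" using augment Ki B by blast
    have "e \<notin> B - X" using e maximal_in_eqI[OF K(2), of e] Ki by blast
    then have "e \<in> J - I" using e K(1) BX by blast
    moreover have "insert e I \<in> \<I>" using indep_subset[OF e(2), of "insert e I"] K(1) by blast
    ultimately show False using no by blast
  qed
  have "B - X \<subseteq> K" using key[OF Kb] Ki I by blast
  have "K \<subseteq> insert x I \<union> (B - X)" "insert x I \<union> (B - X) \<subseteq> E"
    "insert x I \<subseteq> insert x I \<union> (B - X)" using Ki x X I BE by blast+
  from extend_spanning[OF Kb this(1,2) x(3) this(3)]
  obtain P where P: "insert x I \<subseteq> P" "P \<subseteq> insert x I \<union> (B - X)" "maximal_in \<I> P" .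
  have "B - X \<subseteq> P" using key[OF P(3)] P x I by blast
  then have "K \<subseteq> P" using P Ki by blast
  then have "P = K" using maximal_inD(2)[OF Kb] maximal_inD(1)[OF P(3)] by blast
  then show False using P(1) Ki(2) x by blast
qed

lemma dependent_contains_circuit:
  assumes X: "X \<subseteq> E" "X \<notin> \<I>"
  shows "\<exists>C\<in>circuits E \<I>. C \<subseteq> X"
proof -
  obtain J where J: "maximal_in (\<I> \<inter> Pow X) J" using extend[of X "{}"] X empty_indep by blast
  have Ji: "J \<in> \<I>" "J \<subseteq> X" using maximal_inD(1)[OF J] by auto
  then obtain e where e: "e \<in> X" "e \<notin> J" using X(2) by (metis subset_antisym subsetI)
  let ?Y = "insert e J"
  have Yd: "?Y \<notin> \<I>" using maximal_in_eqI[OF J, of e] e Ji by blast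
  define C where "C = {x \<in> ?Y. ?Y - {x} \<in> \<I>}"
  have eC: "e \<in> C" using Ji e unfolding C_def by auto
  have "C \<notin> \<I>"
  proof
    assume "C \<in> \<I>"
    moreover have "C \<subseteq> ?Y" unfolding C_def by blast
    moreover have YE: "?Y \<subseteq> E" using e Ji X by blast
    ultimately obtain D where D: "C \<subseteq> D" "maximal_in (\<I> \<inter> Pow ?Y) D"
      using extend[of ?Y C] by blast
    have Di: "D \<in> \<I>" "D \<subseteq> ?Y" using maximal_inD(1)[OF D(2)] by auto
    then obtain x where x: "x \<in> ?Y" "x \<notin> D" using Yd by (metis subset_antisym subsetI)
    have xJ: "x \<in> J" "x \<noteq> e" using x eC D(1) by auto
    have Jx: "J - {x} \<in> \<I>" using indep_subset[OF Ji(1)] by blast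
    have "insert x (J - {x}) \<in> \<I>" using xJ Ji by (simp add: insert_absorb)
    then obtain y where y: "y \<in> D - (J - {x})" "insert y (J - {x}) \<in> \<I>"
      using augment_restrict[OF YE D(2) Jx, of x] xJ by blast
    have "y = e" using y x Di by blast
    then have "?Y - {x} \<in> \<I>" using y(2) xJ by (simp add: insert_Diff_if)
    then have "x \<in> C" using x unfolding C_def by blast
    then show False using x D by blast
  qed
  moreover have "D \<in> \<I>" if DC: "D \<subset> C" for D
  proof -
    obtain x where "x \<in> C" "x \<notin> D" using DC by blast
    then show ?thesis using indep_subset[of "?Y - {x}" D] DC unfolding C_def by blast
  qed
  moreover have "C \<subseteq> X" using Ji e unfolding C_def by blast
  ultimately show ?thesis unfolding circuits_def using X(1) by blast
qed

lemma indep_iff_no_circuit: "I \<in> \<I> \<longleftrightarrow> I \<subseteq> E \<and> \<not> (\<exists>C\<in>circuits E \<I>. C \<subseteq> I)"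
proof
  assume "I \<in> \<I>"
  then show "I \<subseteq> E \<and> \<not> (\<exists>C\<in>circuits E \<I>. C \<subseteq> I)"
    using indep_in_ground[of I] indep_subset[of I] unfolding circuits_def by blast
qed (use dependent_contains_circuit in blast)

lemma bases_dual: "bases (dual E \<I>) = (\<lambda>B. E - B) ` bases \<I>"
proof -
  have anti: "B = B'" if "maximal_in \<I> B" "maximal_in \<I> B'" "E - B \<subseteq> E - B'" for B B'
  proof -
    have "B' \<subseteq> B" using that(3) indep_in_ground[OF maximal_inD(1)[OF that(2)]] by blast
    then show ?thesis using maximal_inD[OF that(2)] maximal_inD(1)[OF that(1)] by blast
  qed
  show ?thesis
  proof (intro equalityI subsetI)
    fix X assume "X \<in> bases (dual E \<I>)"
    then have m: "maximal_in (dual E \<I>) X" unfolding bases_def by blast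
    then obtain B where B: "B \<in> bases \<I>" "X \<subseteq> E - B"
      using maximal_inD(1)[OF m] unfolding dual_def by blast
    then have "E - B \<in> dual E \<I>" unfolding dual_def by blast
    then have "E - B = X" using maximal_inD(2)[OF m] B by blast
    then show "X \<in> (\<lambda>B. E - B) ` bases \<I>" using B by blast
  next
    fix X assume "X \<in> (\<lambda>B. E - B) ` bases \<I>"
    then obtain B where B: "maximal_in \<I> B" "X = E - B" unfolding bases_def by blast
    have "Y = X" if Y: "Y \<in> dual E \<I>" "X \<subseteq> Y" for Y
    proof -
      obtain B' where B': "maximal_in \<I> B'" "Y \<subseteq> E - B'"
        using Y unfolding dual_def bases_def by blast
      then have "B = B'" using anti B Y by blast
      then show ?thesis using B B' Y by blast
    qed
    moreover have "X \<in> dual E \<I>" using B unfolding dual_def bases_def by blast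
    ultimately show "X \<in> bases (dual E \<I>)" unfolding bases_def maximal_in_def by blast
  qed
qed

lemma matroid_dual: "matroid E (dual E \<I>)"
proof
  show "dual E \<I> \<subseteq> Pow E" unfolding dual_def by blast
  obtain B where "maximal_in \<I> B" using extend_base empty_indep by blast
  then show "{} \<in> dual E \<I>" unfolding dual_def bases_def by blast
  show "\<And>J I. J \<in> dual E \<I> \<Longrightarrow> I \<subseteq> J \<Longrightarrow> I \<in> dual E \<I>" unfolding dual_def by blast
next
  fix I J assume I: "I \<in> dual E \<I>" "\<not> maximal_in (dual E \<I>) I" and J: "maximal_in (dual E \<I>) J"
  obtain B where B: "maximal_in \<I> B" "I \<subseteq> E - B" using I unfolding dual_def bases_def by blast
  have "J \<in> (\<lambda>B. E - B) ` bases \<I>" using J bases_dual unfolding bases_def by blast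
  then obtain B' where B': "maximal_in \<I> B'" "J = E - B'" unfolding bases_def by blast
  have BE: "B \<subseteq> E" "B' \<subseteq> E" "B' \<in> \<I>" using B B' maximal_inD(1) indep_in_ground by blast+
  obtain D where D: "B' \<inter> (E - I) \<subseteq> D" "D \<subseteq> E - I" "maximal_in \<I> D"
    using extend_spanning[OF B(1), of "E - I" "B' \<inter> (E - I)"] B BE
      indep_subset[OF BE(3), of "B' \<inter> (E - I)"] by blast
  have "\<exists>e. e \<in> E - I - D \<and> e \<notin> B'"
  proof (rule ccontr)
    assume "\<not> ?thesis"
    then have "D = E - I" using D by blast
    then have "I = E - D" using B by blast
    then have "I \<in> bases (dual E \<I>)" using bases_dual D(3) unfolding bases_def by blast
    then show False using I unfolding bases_def by blast
  qed
  then obtain e where "e \<in> E - I - D" "e \<notin> B'" by blast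
  moreover from this have "insert e I \<subseteq> E - D" using B D by blast
  ultimately show "\<exists>e\<in>J - I. insert e I \<in> dual E \<I>"
    using D(3) B' unfolding dual_def bases_def by blast
next
  fix X I assume X: "X \<subseteq> E" and I: "I \<in> dual E \<I> \<inter> Pow X"
  obtain B where B: "maximal_in \<I> B" "I \<subseteq> E - B" using I unfolding dual_def bases_def by blast
  obtain K where K: "maximal_in (\<I> \<inter> Pow (E - X)) K"
    using extend[of "E - X" "{}"] empty_indep by blast
  have Ki: "K \<in> \<I>" "K \<subseteq> E - X" using maximal_inD(1)[OF K] by auto
  have "B \<subseteq> E - I" using B indep_in_ground[OF maximal_inD(1)[OF B(1)]] by blast
  then obtain L where L: "K \<subseteq> L" "L \<subseteq> E - I" "maximal_in \<I> L"
    using extend_spanning[OF B(1) _ Diff_subset Ki(1)] Ki(2) I by (metis Diff_mono IntD2 PowD order_refl subset_trans)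
  have Li: "L \<in> \<I>" using L maximal_inD by blast
  have "Y = X - L" if Y: "Y \<in> dual E \<I> \<inter> Pow X" "X - L \<subseteq> Y" for Y
  proof (rule ccontr)
    assume "Y \<noteq> X - L"
    then obtain y where y: "y \<in> Y" "y \<in> L" "y \<in> X" using Y by blast
    obtain L' where L': "maximal_in \<I> L'" "Y \<subseteq> E - L'"
      using Y unfolding dual_def bases_def by blast
    have ps: "L - {y} \<subset> L" using y by blast
    obtain z where z: "z \<in> L' - (L - {y})" "insert z (L - {y}) \<in> \<I>"
      using augment[OF indep_subset[OF Li] L'(1) not_maximal_psubset[OF Li ps]] by blast
    have "z \<noteq> y" using z L' y by blast
    then have "z \<notin> L" using z by blast
    then have "z \<notin> X" using z Y L' by blast
    moreover have "z \<in> E" using z indep_in_ground by blast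
    moreover have "insert z K \<in> \<I>" using indep_subset[OF z(2), of "insert z K"] L(1) Ki y by blast
    ultimately have "z \<in> K" using maximal_in_eqI[OF K, of z] Ki by blast
    then show False using \<open>z \<notin> L\<close> L by blast
  qed
  moreover have "X - L \<in> dual E \<I> \<inter> Pow X" using L X unfolding dual_def bases_def by blast
  ultimately have "maximal_in (dual E \<I> \<inter> Pow X) (X - L)" unfolding maximal_in_def by blast
  moreover have "I \<subseteq> X - L" using L I by blast
  ultimately show "\<exists>J. I \<subseteq> J \<and> maximal_in (dual E \<I> \<inter> Pow X) J" by blast
qed

lemma dual_unique:
  assumes "matroid E \<D>" "bases \<D> = (\<lambda>B. E - B) ` bases \<I>"
  shows "\<D> = dual E \<I>"
proof -
  have *: "A \<in> \<J> \<longleftrightarrow> (\<exists>B\<in>bases \<J>. A \<subseteq> B)" if "matroid E \<J>" for A and \<J>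
    using matroid.extend_base[OF that] matroid.indep_subset[OF that] maximal_inD(1)
    unfolding bases_def by (metis mem_Collect_eq)
  show ?thesis
    by (rule set_eqI) (simp only: *[OF assms(1)] *[OF matroid_dual] assms(2) bases_dual)
qed

lemma circuits_finitarization: "circuits E (finitarization E \<I>) = {C \<in> circuits E \<I>. finite C}"
proof (intro equalityI subsetI)
  fix C assume C: "C \<in> circuits E (finitarization E \<I>)"
  then have "C \<subseteq> E" "C \<notin> finitarization E \<I>" unfolding circuits_def by simp_all
  then obtain D where D: "D \<in> circuits E \<I>" "finite D" "D \<subseteq> C"
    unfolding finitarization_def by blast
  have "D \<notin> finitarization E \<I>" using D unfolding finitarization_def by blast
  then have "D = C" using C D unfolding circuits_def by blast
  then show "C \<in> {C \<in> circuits E \<I>. finite C}" using D by blast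
next
  fix C assume C: "C \<in> {C \<in> circuits E \<I>. finite C}"
  then have "C \<notin> finitarization E \<I>" unfolding finitarization_def by blast
  moreover have "D \<in> finitarization E \<I>" if "D \<subset> C" for D
  proof -
    have "D \<in> \<I>" using C that unfolding circuits_def by blast
    then show ?thesis using indep_iff_no_circuit unfolding finitarization_def by blast
  qed
  ultimately show "C \<in> circuits E (finitarization E \<I>)" using C unfolding circuits_def by blast
qed

lemma finite_indep_finitarization:
  assumes "X \<in> finitarization E \<I>" "Y \<subseteq> X" "finite Y"
  shows "Y \<in> \<I>"
proof (rule ccontr)
  assume "Y \<notin> \<I>"
  then obtain C where "C \<in> circuits E \<I>" "C \<subseteq> Y"
    using dependent_contains_circuit[of Y] assms unfolding finitarization_def by blast
  moreover from this have "finite C" using assms finite_subset by blast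
  ultimately show False using assms unfolding finitarization_def by blast
qed

lemma finitarization_dependentE:
  assumes "X \<in> finitarization E \<I>" "e \<in> E" "insert e X \<notin> finitarization E \<I>"
  obtains C where "C \<in> circuits E \<I>" "finite C" "e \<in> C" "C - {e} \<subseteq> X"
proof -
  obtain C where "C \<in> circuits E \<I>" "finite C" "C \<subseteq> insert e X"
    using assms unfolding finitarization_def by blast
  moreover from this have "e \<in> C" using assms(1) unfolding finitarization_def by blast
  ultimately show thesis using that by blast
qed

lemma matroid_finitarization: "matroid E (finitarization E \<I>)"
proof
  let ?F = "finitarization E \<I>"
  show "?F \<subseteq> Pow E" unfolding finitarization_def by blast
  show "{} \<in> ?F" using empty_indep unfolding finitarization_def circuits_def by auto
  show "\<And>J I. J \<in> ?F \<Longrightarrow> I \<subseteq> J \<Longrightarrow> I \<in> ?F" unfolding finitarization_def by blast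
next
  let ?F = "finitarization E \<I>"
  fix I J assume I: "I \<in> ?F" "\<not> maximal_in ?F I" and J: "maximal_in ?F J"
  have JF: "J \<in> ?F" using J maximal_inD by blast
  have JE: "J \<subseteq> E" using JF unfolding finitarization_def by blast
  obtain I' where I': "I' \<in> ?F" "I \<subset> I'" using I unfolding maximal_in_def by blast
  then obtain f where f: "f \<in> I'" "f \<notin> I" by blast
  have fI: "insert f I \<in> ?F" using f I' unfolding finitarization_def by blast
  then have fE: "f \<in> E" unfolding finitarization_def by blast
  show "\<exists>e\<in>J - I. insert e I \<in> ?F"
  proof (rule ccontr)
    assume no: "\<not> ?thesis"
    then have fJ: "f \<notin> J" using f fI by blast
    have "insert f J \<notin> ?F" using maximal_in_eqI[OF J] fJ by blast
    then obtain D where D: "D \<in> circuits E \<I>" "finite D" "f \<in> D" "D - {f} \<subseteq> J"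
      using finitarization_dependentE[OF JF fE] by blast
    have "\<forall>e\<in>J - I. \<exists>C. C \<in> circuits E \<I> \<and> finite C \<and> e \<in> C \<and> C - {e} \<subseteq> I"
      using finitarization_dependentE[OF I(1)] no JE by (metis DiffD1 subsetD)
    then obtain c where c: "\<And>e. e \<in> J - I \<Longrightarrow>
        c e \<in> circuits E \<I> \<and> finite (c e) \<and> e \<in> c e \<and> c e - {e} \<subseteq> I"
      by metis
    define A where "A = D - {f}"
    define I0 where "I0 = (A \<inter> I) \<union> (\<Union>e\<in>A - I. c e - {e})"
    have AJ: "A \<subseteq> J" "finite A" using D unfolding A_def by auto
    have I0: "I0 \<subseteq> I" "finite I0" using c AJ unfolding I0_def by auto
    define K where "K = I0 \<union> A"
    have I0i: "I0 \<in> \<I>" using finite_indep_finitarization[OF I(1)] I0 by blast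
    have fI0: "insert f I0 \<in> \<I>" using finite_indep_finitarization[OF fI, of "insert f I0"] I0 by blast
    have KE: "K \<subseteq> E" "insert f K \<subseteq> E"
      using I0i indep_in_ground AJ JE fE unfolding K_def by blast+
    have I0max: "insert e I0 \<notin> \<I>" if "e \<in> K" "e \<notin> I0" for e
    proof
      assume a: "insert e I0 \<in> \<I>"
      have e: "e \<in> A - I" using that unfolding K_def I0_def by blast
      then have "c e \<subseteq> insert e I0" unfolding I0_def by blast
      then have "c e \<in> \<I>" using indep_subset[OF a] by blast
      then show False using c[of e] e AJ unfolding circuits_def by blast
    qed
    have "A \<in> \<I>" using D unfolding A_def circuits_def by blast
    then obtain K1 where K1: "A \<subseteq> K1" "maximal_in (\<I> \<inter> Pow K) K1"
      using extend[OF KE(1), of A] unfolding K_def by blast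
    have K1i: "K1 \<in> \<I>" "K1 \<subseteq> K" using maximal_inD(1)[OF K1(2)] by auto
    have "maximal_in (\<I> \<inter> Pow (insert f K)) K1"
    proof -
      have "Y = K1" if Y: "Y \<in> \<I>" "Y \<subseteq> insert f K" "K1 \<subseteq> Y" for Y
      proof -
        have "f \<notin> Y"
        proof
          assume "f \<in> Y"
          then have "D \<subseteq> Y" using K1 Y unfolding A_def by blast
          then have "D \<in> \<I>" using indep_subset Y by blast
          then show False using D unfolding circuits_def by blast
        qed
        then show ?thesis using maximal_inD(2)[OF K1(2), of Y] Y by blast
      qed
      then show ?thesis using K1i unfolding maximal_in_def by blast
    qed
    then obtain e where "e \<in> K1 - I0" "insert e I0 \<in> \<I>"
      using augment_restrict[OF KE(2) _ I0i, of K1 f] fI0 f I0 unfolding K_def by blast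
    then show False using I0max K1i by blast
  qed
next
  let ?F = "finitarization E \<I>"
  fix X I assume X: "X \<subseteq> E" and I: "I \<in> ?F \<inter> Pow X"
  let ?S = "{Y \<in> ?F \<inter> Pow X. I \<subseteq> Y}"
  have "\<exists>M\<in>?S. \<forall>Y\<in>?S. M \<subseteq> Y \<longrightarrow> Y = M"
  proof (rule subset_Zorn_nonempty)
    show "?S \<noteq> {}" using I by blast
  next
    fix \<C> assume ne: "\<C> \<noteq> {}" and ch: "subset.chain ?S \<C>"
    have sub: "\<C> \<subseteq> ?S" using ch unfolding subset.chain_def by blast
    have False if C: "C \<in> circuits E \<I>" "finite C" "C \<subseteq> \<Union>\<C>" for C
    proof -
      obtain Y where "Y \<in> \<C>" "C \<subseteq> Y"
        using finite_subset_Union_chain[OF C(2,3) ne ch] by blast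
      then show False using sub C unfolding finitarization_def by blast
    qed
    then show "\<Union>\<C> \<in> ?S" using sub ne X unfolding finitarization_def by blast
  qed
  then obtain M where "M \<in> ?S" "\<forall>Y\<in>?S. M \<subseteq> Y \<longrightarrow> Y = M" by blast
  then have "I \<subseteq> M" "maximal_in (?F \<inter> Pow X) M"
    unfolding maximal_in_def by (simp, metis (no_types, lifting) mem_Collect_eq subset_trans)
  then show "\<exists>J. I \<subseteq> J \<and> maximal_in (?F \<inter> Pow X) J" by blast
qed

lemma finitarization_unique:
  assumes "matroid E \<F>" "circuits E \<F> = {C \<in> circuits E \<I>. finite C}"
  shows "\<F> = finitarization E \<I>"
  by (rule set_eqI)
    (auto simp: matroid.indep_iff_no_circuit[OF assms(1)] assms(2) finitarization_def)

end

end

(*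
  A nearly (co)finitary matroid differs from its (co)finitary companion only by finite sets. So a
  solution for the companions yields a common independent set of M and N with finite defect, finitely
  many augmentations turn it into one without augmenting path, and the region reachable from the
  elements not spanned in N is then the M-side of the bipartition. A finitary and a cofinitary matroid
  are treated by compactness, two cofinitary ones by duality.

  For two finitary matroids on a countable set, contract a maximal wave (a set W with an M-base that
  is N-independent over E - W) in M and delete it from N. In the remaining wave-free pair the elements
  are spanned in N one after the other by common independent sets whose contraction creates only
  trivial waves. If some element could not be spanned, then the regions reachable from all elements
  that turn out unspannable would be left untouched by later augmentations, and their union would be
  a nontrivial wave.
*)
theory Submission
  imports Defs
begin

section \<open>Matroid closure operators\<close>

text \<open>Two facts replace arguments with finite circuits: an element spanned by an independent
  set is spanned by its fundamental circuit (\<open>fundamental\<close>), and sets that are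
  independent over one another can be united (\<open>cindep_Un\<close>). Both rest on relative bases
  only, so finite augmenting paths work in arbitrary infinite matroids. After a finite change
  finitely many augmentations suffice because Steinitz bounds the possible gain. The obstacle is the
  finitary pair, where infinitely many augmentations may be needed and neither a maximum nor a limit
  is at hand. Waves replace the missing min-max bound: a wave is finished on its
  \<open>M\<close>-side, and only when none is left can the whole rest be expected to be spanned in
  \<open>N\<close>. If \<open>N\<close> is dual to a finitary \<open>P\<close>, common independent
  sets of \<open>M\<close> and \<open>N\<close> correspond to unions of an
  \<open>M\<close>-independent and a \<open>P\<close>-independent set; being such a union is decided
  on finite subsets, which is what compactness needs.\<close>

definition cindep :: "('a set \<Rightarrow> 'a set) \<Rightarrow> 'a set \<Rightarrow> bool" where
  "cindep cl X \<longleftrightarrow> (\<forall>x\<in>X. x \<notin> cl (X - {x}))"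

text \<open>Contraction that keeps the ground set: elements of \<open>Z\<close> stay as loops, so
  iterated contractions collapse into one.\<close>

definition contr :: "('a set \<Rightarrow> 'a set) \<Rightarrow> 'a set \<Rightarrow> 'a set \<Rightarrow> 'a set" where
  "contr cl Z = (\<lambda>X. cl (X \<union> Z))"

lemma cindep_empty [simp]: "cindep cl {}"
  unfolding cindep_def by simp

lemma contr_empty [simp]: "contr cl {} = cl"
  unfolding contr_def by simp

lemma contr_contr [simp]: "contr (contr cl Z) Z' = contr cl (Z \<union> Z')"
  unfolding contr_def by (simp add: Un_ac)

locale exchange_closure =
  fixes cl :: "'a set \<Rightarrow> 'a set"
  assumes ext: "X \<subseteq> cl X"
    and mono: "X \<subseteq> Y \<Longrightarrow> cl X \<subseteq> cl Y"
    and idem: "cl (cl X) = cl X"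
    and exchange: "x \<in> cl (insert y X) \<Longrightarrow> x \<notin> cl X \<Longrightarrow> y \<in> cl (insert x X)"
begin

lemma cl_least: "X \<subseteq> cl Y \<Longrightarrow> cl X \<subseteq> cl Y"
  using mono[of X "cl Y"] idem by simp

lemma cl_eqI: "X \<subseteq> cl Y \<Longrightarrow> Y \<subseteq> cl X \<Longrightarrow> cl X = cl Y"
  using cl_least by blast

lemma cl_Un_cl: "cl (X \<union> cl Y) = cl (X \<union> Y)"
  by (rule cl_eqI) (use ext mono[of Y "X \<union> Y"] mono[of "X \<union> Y" "X \<union> cl Y"] in blast)+

lemma exchange_closure_contr: "exchange_closure (contr cl Z)"
proof
  show "X \<subseteq> contr cl Z X" for X unfolding contr_def using ext by blast
  show "contr cl Z X \<subseteq> contr cl Z Y" if "X \<subseteq> Y" for X Y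
    unfolding contr_def by (rule mono) (use that in blast)
  show "contr cl Z (contr cl Z X) = contr cl Z X" for X
    unfolding contr_def by (rule cl_eqI) (use ext[of "X \<union> Z"] ext[of "cl (X \<union> Z) \<union> Z"] in blast)+
  show "y \<in> contr cl Z (insert x X)" if "x \<in> contr cl Z (insert y X)" "x \<notin> contr cl Z X" for x y X
    using that exchange[of x y "X \<union> Z"] unfolding contr_def by simp
qed

lemma contr_cong: "cl A = cl B \<Longrightarrow> contr cl A = contr cl B"
  unfolding contr_def by (metis cl_Un_cl)

lemma cindep_subset: "cindep cl X \<Longrightarrow> Y \<subseteq> X \<Longrightarrow> cindep cl Y"
  unfolding cindep_def by (meson Diff_mono mono order_refl subsetD)

lemma cindep_contr_mono:
  assumes "cindep (contr cl Z) X" "Z' \<subseteq> cl Z"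
  shows "cindep (contr cl Z') X"
  unfolding cindep_def contr_def
proof
  fix x assume x: "x \<in> X"
  have "(X - {x}) \<union> Z' \<subseteq> cl ((X - {x}) \<union> Z)"
    using assms(2) ext[of "(X - {x}) \<union> Z"] mono[of Z "(X - {x}) \<union> Z"] by blast
  then have "cl ((X - {x}) \<union> Z') \<subseteq> cl ((X - {x}) \<union> Z)" by (rule cl_least)
  then show "x \<notin> cl ((X - {x}) \<union> Z')" using assms(1) x unfolding cindep_def contr_def by blast
qed

lemma cindep_contr_disjoint: "cindep (contr cl Z) X \<Longrightarrow> X \<inter> cl Z = {}"
  unfolding cindep_def contr_def by (meson disjoint_iff mono subsetD sup_ge2)

lemma cindep_contr_subset: "cindep (contr cl Z) X \<Longrightarrow> Y \<subseteq> X \<Longrightarrow> cindep (contr cl Z) Y"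
  by (rule exchange_closure.cindep_subset[OF exchange_closure_contr])

lemma cindep_insert:
  assumes "cindep cl X" "x \<notin> cl X"
  shows "cindep cl (insert x X)"
  unfolding cindep_def
proof
  fix y assume y: "y \<in> insert x X"
  have xX: "x \<notin> X" using assms ext by blast
  show "y \<notin> cl (insert x X - {y})"
  proof (cases "y = x")
    case True with assms xX show ?thesis by simp
  next
    case False
    with y have yX: "y \<in> X" by blast
    have eq: "insert x X - {y} = insert x (X - {y})" "insert y (X - {y}) = X"
      using False yX by auto
    show ?thesis
      using exchange[of y x "X - {y}"] assms yX unfolding eq cindep_def by metis
  qed
qed

lemma exchange_remove:
  assumes "y \<in> I" "x \<in> cl I" "x \<notin> cl (I - {y})"
  shows "y \<in> cl (insert x (I - {y}))"
  using exchange[of x y "I - {y}"] assms by (simp add: insert_absorb)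

lemma swap_cl:
  assumes "y \<in> I" "x \<in> cl I" "x \<notin> cl (I - {y})"
  shows "cl (insert x (I - {y})) = cl I"
proof (rule cl_eqI)
  show "insert x (I - {y}) \<subseteq> cl I" using assms ext by blast
  show "I \<subseteq> cl (insert x (I - {y}))"
    using exchange_remove[OF assms] ext[of "insert x (I - {y})"] by blast
qed

lemma swap_cindep:
  assumes "cindep cl I" "x \<notin> cl (I - {y})"
  shows "cindep cl (insert x (I - {y}))"
  using cindep_insert[OF cindep_subset[OF assms(1)]] assms(2) by blast

end

text \<open>The operator varies in the induction: an \<open>x\<close> in \<open>X\<close> outside
  \<open>cl Y\<close> is traded for \<open>y\<close> by contracting \<open>{x}\<close>, after which
  the rest of \<open>X\<close> lies in the closure of \<open>Y\<close>.\<close>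

lemma steinitz:
  fixes X Y :: "'a set"
  assumes "finite Y" "exchange_closure cl" "cindep cl X" "X \<subseteq> cl Y"
  shows "finite X \<and> card X \<le> card Y"
  using assms
proof (induction Y arbitrary: cl X rule: finite_induct)
  case empty
  interpret exchange_closure cl by fact
  have "X = {}" using empty.prems mono[of "{}"] unfolding cindep_def by blast
  then show ?case by simp
next
  case (insert y Y)
  interpret exchange_closure cl by fact
  show ?case
  proof (cases "X \<subseteq> cl Y")
    case True
    then show ?thesis using insert.IH[OF insert.prems(1,2)] insert.hyps by auto
  next
    case False
    then obtain x where x: "x \<in> X" "x \<notin> cl Y" by blast
    have eq: "insert x (X - {x}) = X" using x by auto
    have "y \<in> cl (insert x Y)" using exchange[of x y Y] x insert.prems(3) by blast
    then have "insert y Y \<subseteq> cl (insert x Y)" using ext by blast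
    then have "cl (insert y Y) \<subseteq> cl (insert x Y)" by (rule cl_least)
    then have sub: "X - {x} \<subseteq> contr cl {x} Y"
      using insert.prems(3) unfolding contr_def by auto
    have "cindep (contr cl {x}) (X - {x})"
      unfolding cindep_def contr_def
    proof
      fix z assume z: "z \<in> X - {x}"
      then have "X - {x} - {z} \<union> {x} = X - {z}" using x by blast
      then show "z \<notin> cl (X - {x} - {z} \<union> {x})" using insert.prems(2) z unfolding cindep_def by auto
    qed
    from insert.IH[OF exchange_closure_contr this sub]
    have "finite (X - {x})" "card (X - {x}) \<le> card Y" by auto
    then show ?thesis using x insert.hyps by (auto simp: card_Diff_singleton_if)
  qed
qed

locale closure_matroid = exchange_closure +
  assumes base: "cindep cl I \<Longrightarrow> I \<subseteq> X \<Longrightarrow> \<exists>J. I \<subseteq> J \<and> J \<subseteq> X \<and> cindep cl J \<and> X \<subseteq> cl J"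
begin

text \<open>An element of \<open>Y\<close> missing from a base of \<open>X \<union> Y\<close>
  through \<open>X\<close> would be spanned by \<open>Z\<close> and the rest of
  \<open>Y\<close>.\<close>

lemma cindep_Un:
  assumes X: "cindep cl X" "X \<subseteq> cl Z" and Y: "cindep (contr cl Z) Y"
  shows "cindep cl (X \<union> Y)"
proof -
  obtain J where J: "X \<subseteq> J" "J \<subseteq> X \<union> Y" "cindep cl J" "X \<union> Y \<subseteq> cl J"
    using base[OF X(1), of "X \<union> Y"] by blast
  have "y \<in> J" if y: "y \<in> Y" for y
  proof (rule ccontr)
    assume "y \<notin> J"
    then have "J \<subseteq> cl ((Y - {y}) \<union> Z)"
      using J X ext[of "(Y - {y}) \<union> Z"] mono[of Z "(Y - {y}) \<union> Z"] by blast
    then have "cl J \<subseteq> cl ((Y - {y}) \<union> Z)" by (rule cl_least)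
    then have "y \<in> cl ((Y - {y}) \<union> Z)" using J y by blast
    then show False using Y y unfolding cindep_def contr_def by blast
  qed
  then have "J = X \<union> Y" using J by blast
  then show ?thesis using J by simp
qed

lemma cindep_contr_diff:
  assumes "cindep cl J" "Z \<subseteq> cl (J \<inter> Z)"
  shows "cindep (contr cl Z) (J - Z)"
  unfolding cindep_def contr_def
proof
  fix x assume x: "x \<in> J - Z"
  have "(J - Z - {x}) \<union> Z \<subseteq> cl (J - {x})"
    using assms(2) x ext[of "J - {x}"] mono[of "J \<inter> Z" "J - {x}"] by blast
  then have "cl ((J - Z - {x}) \<union> Z) \<subseteq> cl (J - {x})" by (rule cl_least)
  then show "x \<notin> cl ((J - Z - {x}) \<union> Z)" using assms(1) x unfolding cindep_def by blast
qed

text \<open>The set is the fundamental circuit of \<open>x\<close> without \<open>x\<close>, or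
  \<open>{x}\<close> if \<open>x\<close> is in \<open>I\<close>. If it did not span
  \<open>x\<close>, then it would extend together with \<open>x\<close> to a base of
  \<open>I + x\<close>; this base omits some \<open>y\<close> of \<open>I\<close>, which would then
  be spanned by \<open>I - {y}\<close>.\<close>

lemma fundamental:
  assumes I: "cindep cl I" and x: "x \<in> cl I"
  shows "x \<in> cl {y \<in> I. x \<notin> cl (I - {y})}"
proof (rule ccontr)
  let ?C = "{y \<in> I. x \<notin> cl (I - {y})}"
  assume n: "x \<notin> cl ?C"
  have "cindep cl (insert x ?C)" by (rule cindep_insert[OF cindep_subset[OF I] n]) blast
  then obtain J where J: "insert x ?C \<subseteq> J" "J \<subseteq> insert x I" "cindep cl J" "insert x I \<subseteq> cl J"
    using base[of "insert x ?C" "insert x I"] by blast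
  show False
  proof (cases "I - {x} \<subseteq> J - {x}")
    case True
    have "x \<notin> I"
    proof
      assume "x \<in> I"
      then have "x \<in> ?C" using I unfolding cindep_def by blast
      with ext have "x \<in> cl ?C" by (rule subsetD)
      with n show False by contradiction
    qed
    then have "x \<in> cl (J - {x})" using True x mono[of I "J - {x}"] by auto
    then show False using J unfolding cindep_def by blast
  next
    case False
    then obtain y where y: "y \<in> I" "y \<noteq> x" "y \<notin> J" by blast
    then have "y \<notin> ?C" using J(1) by blast
    then have xy: "x \<in> cl (I - {y})" using y by simp
    have "J \<subseteq> cl (I - {y})" using J y xy ext[of "I - {y}"] by blast
    then have "cl J \<subseteq> cl (I - {y})" by (rule cl_least)
    then have "y \<in> cl (I - {y})" using J y by blast
    then show False using I y unfolding cindep_def by blast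
  qed
qed

text \<open>Both sets contain the fundamental circuit of \<open>x\<close> in
  \<open>I\<close>.\<close>

lemma cl_Int:
  assumes I: "cindep cl I" and A: "A \<subseteq> I" "x \<in> cl A" and B: "B \<subseteq> I" "x \<in> cl B"
  shows "x \<in> cl (A \<inter> B)"
proof -
  have "x \<in> cl I" using A mono by blast
  moreover have "{y \<in> I. x \<notin> cl (I - {y})} \<subseteq> A \<inter> B"
  proof
    fix y assume y: "y \<in> {y \<in> I. x \<notin> cl (I - {y})}"
    then show "y \<in> A \<inter> B" using A B mono[of A "I - {y}"] mono[of B "I - {y}"] by blast
  qed
  ultimately show ?thesis using fundamental[OF I] mono by blast
qed

text \<open>
  Swapping \<open>y i\<close> for \<open>x i\<close> in increasing order of \<open>i\<close>: by triangularity the fundamental circuit of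
  \<open>x i\<close> avoids everything removed earlier, so it is still its fundamental circuit at step \<open>i\<close>.
\<close>

lemma triangular_swap:
  fixes k :: nat
  assumes I: "cindep cl I"
    and mem: "\<And>i. i < k \<Longrightarrow> y i \<in> I \<and> x i \<notin> I \<and> x i \<in> cl I \<and> x i \<notin> cl (I - {y i})"
    and tri: "\<And>i j. i < j \<Longrightarrow> j < k \<Longrightarrow> x j \<in> cl (I - {y i})"
  shows "cindep cl (I - y ` {..<k} \<union> x ` {..<k}) \<and> cl (I - y ` {..<k} \<union> x ` {..<k}) = cl I"
  using mem tri
proof (induction k)
  case 0
  then show ?case using I by simp
next
  case (Suc k)
  let ?I = "I - y ` {..<k} \<union> x ` {..<k}"
  have IH: "cindep cl ?I" "cl ?I = cl I" using Suc by auto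
  have yk: "y k \<in> I" "x k \<notin> I" "x k \<in> cl I" "x k \<notin> cl (I - {y k})" using Suc.prems(1) by auto
  have "y k \<noteq> y i" if "i < k" for i using Suc.prems(2)[of i k] that yk by auto
  moreover have "y k \<noteq> x i" if "i < k" for i using Suc.prems(1)[of i] that yk by auto
  moreover from this have "y k \<notin> x ` {..<k}" by blast
  ultimately have ykI: "y k \<in> ?I" using yk by auto
  let ?C = "{z \<in> I. x k \<notin> cl (I - {z})}"
  have C: "x k \<in> cl ?C" by (rule fundamental[OF I yk(3)])
  have CI: "?C \<subseteq> ?I"
  proof
    fix z assume "z \<in> ?C"
    then show "z \<in> ?I" using Suc.prems(2)[of _ k] by auto
  qed
  \<comment> \<open>Otherwise, within the independent set \<open>?I\<close>, the part of
    \<open>?C\<close> that avoids \<open>y k\<close> would span \<open>x k\<close>; it lies in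
    \<open>I - {y k}\<close>.\<close>
  have nk: "x k \<notin> cl (?I - {y k})"
  proof
    assume "x k \<in> cl (?I - {y k})"
    then have "x k \<in> cl (?C \<inter> (?I - {y k}))" by (rule cl_Int[OF IH(1) CI C Diff_subset])
    moreover have "cl (?C \<inter> (?I - {y k})) \<subseteq> cl (I - {y k})" by (rule mono) auto
    ultimately show False using yk(4) by (meson subsetD)
  qed
  have eq: "I - y ` {..<Suc k} \<union> x ` {..<Suc k} = insert (x k) (?I - {y k})"
    using \<open>y k \<notin> x ` {..<k}\<close> yk(1,2) by (auto simp: lessThan_Suc)
  show ?case
    unfolding eq using swap_cl[OF ykI _ nk] swap_cindep[OF IH(1) nk] yk(3) IH(2) by simp
qed

end

locale finitary_closure = exchange_closure +
  assumes finitary: "x \<in> cl X \<Longrightarrow> \<exists>Y. finite Y \<and> Y \<subseteq> X \<and> x \<in> cl Y"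
begin

lemma finitary_closure_contr: "finitary_closure (contr cl Z)"
proof -
  interpret c: exchange_closure "contr cl Z" by (rule exchange_closure_contr)
  show ?thesis
  proof
    fix x X assume "x \<in> contr cl Z X"
    then obtain Y where "finite Y" "Y \<subseteq> X \<union> Z" "x \<in> cl Y"
      using finitary unfolding contr_def by blast
    then show "\<exists>Y. finite Y \<and> Y \<subseteq> X \<and> x \<in> contr cl Z Y"
      unfolding contr_def using mono[of Y "Y \<inter> X \<union> Z"] by (intro exI[of _ "Y \<inter> X"]) blast
  qed
qed

lemma cindep_Union_chain:
  assumes "\<And>A B. A \<in> \<C> \<Longrightarrow> B \<in> \<C> \<Longrightarrow> A \<subseteq> B \<or> B \<subseteq> A" "\<And>A. A \<in> \<C> \<Longrightarrow> cindep cl A"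
  shows "cindep cl (\<Union>\<C>)"
  unfolding cindep_def
proof
  fix x assume x: "x \<in> \<Union>\<C>"
  show "x \<notin> cl (\<Union>\<C> - {x})"
  proof
    assume "x \<in> cl (\<Union>\<C> - {x})"
    then obtain Y where Y: "finite Y" "Y \<subseteq> \<Union>\<C> - {x}" "x \<in> cl Y"
      using finitary[of x] by auto
    have "finite (insert x Y)" "insert x Y \<subseteq> \<Union>\<C>" "\<C> \<noteq> {}" "subset.chain UNIV \<C>"
      using x Y assms(1) unfolding subset.chain_def by auto
    then obtain A where A: "A \<in> \<C>" "insert x Y \<subseteq> A"
      using finite_subset_Union_chain[of "insert x Y" \<C>] by blast
    then have "x \<in> cl (A - {x})" using Y mono[of Y "A - {x}"] by blast
    then show False using assms(2)[OF A(1)] A(2) unfolding cindep_def by blast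
  qed
qed

end

sublocale finitary_closure \<subseteq> closure_matroid
proof
  fix I X assume I: "cindep cl I" "I \<subseteq> X"
  let ?S = "{J. I \<subseteq> J \<and> J \<subseteq> X \<and> cindep cl J}"
  have "\<exists>M\<in>?S. \<forall>Y\<in>?S. M \<subseteq> Y \<longrightarrow> Y = M"
  proof (rule subset_Zorn_nonempty)
    show "?S \<noteq> {}" using I by blast
  next
    fix \<C> assume ne: "\<C> \<noteq> {}" and ch: "subset.chain ?S \<C>"
    then have sub: "\<C> \<subseteq> ?S" and "\<And>A B. A \<in> \<C> \<Longrightarrow> B \<in> \<C> \<Longrightarrow> A \<subseteq> B \<or> B \<subseteq> A"
      unfolding subset.chain_def by blast+
    then have "cindep cl (\<Union>\<C>)" by (intro cindep_Union_chain) auto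
    then show "\<Union>\<C> \<in> ?S" using ne sub by auto
  qed
  then obtain J where J: "I \<subseteq> J" "J \<subseteq> X" "cindep cl J" and max: "\<forall>Y\<in>?S. J \<subseteq> Y \<longrightarrow> Y = J"
    by auto
  have "X \<subseteq> cl J"
  proof
    fix x assume x: "x \<in> X"
    show "x \<in> cl J"
    proof (rule ccontr)
      assume n: "x \<notin> cl J"
      then have "insert x J \<in> ?S" using J x cindep_insert[OF J(3) n] by auto
      with max have "insert x J = J" by (meson subset_insertI)
      then have "x \<in> J" by blast
      with n ext[of J] show False by blast
    qed
  qed
  then show "\<exists>J. I \<subseteq> J \<and> J \<subseteq> X \<and> cindep cl J \<and> X \<subseteq> cl J" using J by blast
qed

section \<open>Augmenting paths\<close>

primrec layer :: "('a set \<Rightarrow> 'a set) \<Rightarrow> ('a set \<Rightarrow> 'a set) \<Rightarrow> 'a set \<Rightarrow> 'a set \<Rightarrow> 'a set \<Rightarrow> nat \<Rightarrow> 'a set"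
  where
    "layer M N V I T 0 = T"
  | "layer M N V I T (Suc n) = {z \<in> V - I. z \<in> N I \<and>
      (\<exists>x\<in>layer M N V I T n. \<exists>y\<in>I. x \<notin> M (I - {y}) \<and> z \<notin> N (I - {y}))}"

definition reach where
  "reach M N V I T = (\<Union>n. layer M N V I T n)"

text \<open>The \<open>M\<close>-circuits of reached elements are added so that the region is
  spanned by its own part of \<open>I\<close>.\<close>

definition region where
  "region M N V I T = reach M N V I T \<union> {y \<in> I. \<exists>x\<in>reach M N V I T. x \<notin> M (I - {y})}"

text \<open>
  The path runs \<open>x 0, y 0, x 1, \<dots>, y (k - 1), x k\<close>; the third condition excludes shortcuts.
\<close>

definition augmenting_path where
  "augmenting_path M N V I x y (k::nat) \<longleftrightarrow>
    (\<forall>i\<le>k. x i \<in> V - I) \<and>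
    (\<forall>i<k. y i \<in> I \<and> x i \<in> M I \<and> x i \<notin> M (I - {y i}) \<and>
      x (Suc i) \<in> N I \<and> x (Suc i) \<notin> N (I - {y i})) \<and>
    (\<forall>i j. i < j \<longrightarrow> j < k \<longrightarrow> x i \<in> M (I - {y j}) \<and> x (Suc j) \<in> N (I - {y i})) \<and>
    x 0 \<notin> N I \<and> x k \<notin> M I"

definition flip where
  "flip I x y (k::nat) = I - y ` {..<k} \<union> x ` {..k}"

lemma layer_subset: "T \<subseteq> V - I \<Longrightarrow> layer M N V I T n \<subseteq> V - I"
  by (cases n) auto

lemma reach_subset: "T \<subseteq> V - I \<Longrightarrow> reach M N V I T \<subseteq> V - I"
  unfolding reach_def using layer_subset by blast

lemma region_subset: "T \<subseteq> V - I \<Longrightarrow> I \<subseteq> V \<Longrightarrow> region M N V I T \<subseteq> V"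
  unfolding region_def using reach_subset by blast

lemma T_subset_reach: "T \<subseteq> reach M N V I T"
  unfolding reach_def by (metis UN_upper UNIV_I layer.simps(1))

lemma layer_SucI:
  assumes "x \<in> layer M N V I T n" "y \<in> I" "x \<notin> M (I - {y})" "z \<in> V - I" "z \<in> N I" "z \<notin> N (I - {y})"
  shows "z \<in> layer M N V I T (Suc n)"
  using assms by auto

lemma reach_step:
  assumes "x \<in> reach M N V I T" "y \<in> I" "x \<notin> M (I - {y})" "z \<in> V - I" "z \<in> N I" "z \<notin> N (I - {y})"
  shows "z \<in> reach M N V I T"
proof -
  obtain n where "x \<in> layer M N V I T n" using assms(1) unfolding reach_def by blast
  then have "z \<in> layer M N V I T (Suc n)" using assms by auto
  then show ?thesis unfolding reach_def by blast
qed

lemma reach_induct [consumes 1, case_names start step]: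
  assumes "z \<in> reach M N V I T"
    and "\<And>z. z \<in> T \<Longrightarrow> P z"
    and "\<And>x y z. x \<in> reach M N V I T \<Longrightarrow> P x \<Longrightarrow> y \<in> I \<Longrightarrow> x \<notin> M (I - {y}) \<Longrightarrow> z \<in> V - I \<Longrightarrow>
      z \<in> N I \<Longrightarrow> z \<notin> N (I - {y}) \<Longrightarrow> P z"
  shows "P z"
proof -
  obtain n where "z \<in> layer M N V I T n" using assms(1) unfolding reach_def by blast
  then show ?thesis
  proof (induction n arbitrary: z)
    case 0
    then show ?case using assms(2) by simp
  next
    case (Suc n)
    then obtain x y where "x \<in> layer M N V I T n" "y \<in> I" "x \<notin> M (I - {y})" "z \<in> V - I" "z \<in> N I"
      "z \<notin> N (I - {y})" by auto
    moreover from this have "x \<in> reach M N V I T" unfolding reach_def by blast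
    ultimately show ?case using assms(3) Suc.IH by metis
  qed
qed

lemma layer_path:
  assumes "z \<in> layer M N V I T n"
  shows "\<exists>x y. x n = z \<and> x 0 \<in> T \<and> (\<forall>i\<le>n. x i \<in> layer M N V I T i) \<and>
    (\<forall>i<n. y i \<in> I \<and> x i \<notin> M (I - {y i}) \<and> x (Suc i) \<in> N I \<and> x (Suc i) \<notin> N (I - {y i}))"
  using assms
proof (induction n arbitrary: z)
  case 0
  then show ?case by (intro exI[of _ "\<lambda>_. z"]) auto
next
  case (Suc n)
  then obtain u v where uv: "u \<in> layer M N V I T n" "v \<in> I" "u \<notin> M (I - {v})" "z \<in> N I" "z \<notin> N (I - {v})"
    by auto
  from Suc.IH[OF uv(1)] obtain x y where xy: "x n = u" "x 0 \<in> T" "\<forall>i\<le>n. x i \<in> layer M N V I T i"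
    "\<forall>i<n. y i \<in> I \<and> x i \<notin> M (I - {y i}) \<and> x (Suc i) \<in> N I \<and> x (Suc i) \<notin> N (I - {y i})" by blast
  define x' where "x' = x(Suc n := z)"
  define y' where "y' = y(n := v)"
  have "x' i \<in> layer M N V I T i" if "i \<le> Suc n" for i
    using that xy(3) Suc.prems unfolding x'_def by (cases "i = Suc n") auto
  moreover have "y' i \<in> I \<and> x' i \<notin> M (I - {y' i}) \<and> x' (Suc i) \<in> N I \<and> x' (Suc i) \<notin> N (I - {y' i})"
    if "i < Suc n" for i
    using that xy(1,4) uv unfolding x'_def y'_def by (cases "i = n") auto
  ultimately show ?case using xy(2) unfolding x'_def by (intro exI[of _ x'] exI[of _ y']) (auto simp: x'_def)
qed

text \<open>Grafts the tail of a walk onto any other walk to \<open>x j\<close>, which turns a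
  shortcut into a shorter walk.\<close>

lemma layer_shift:
  assumes "\<forall>i\<le>n. x i \<in> V - I"
    and "\<forall>i<n. y i \<in> I \<and> x i \<notin> M (I - {y i}) \<and> x (Suc i) \<in> N I \<and> x (Suc i) \<notin> N (I - {y i})"
    and "x j \<in> layer M N V I T m" "j + d \<le> n"
  shows "x (j + d) \<in> layer M N V I T (m + d)"
  using assms(4)
proof (induction d)
  case 0
  then show ?case using assms(3) by simp
next
  case (Suc d)
  then have *: "x (j + d) \<in> layer M N V I T (m + d)" "j + d < n" "Suc (j + d) \<le> n" by auto
  have "x (Suc (j + d)) \<in> layer M N V I T (Suc (m + d))"
    by (rule layer_SucI[OF *(1), of "y (j + d)"]) (use assms(1,2) * in blast)+
  then show ?case by simp
qed

text \<open>A walk that leaves \<open>M I\<close> with the least number of exchanges has no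
  shortcut, since a shortcut would put its end into an earlier layer.\<close>

lemma augmenting_path_exists:
  assumes T: "T \<subseteq> V - I" "T \<inter> N I = {}" and "z \<in> reach M N V I T" "z \<notin> M I"
  shows "\<exists>x y k. augmenting_path M N V I x y k \<and> x 0 \<in> T"
proof -
  let ?L = "layer M N V I T"
  define P where "P n \<longleftrightarrow> \<not> ?L n \<subseteq> M I" for n
  define k where "k = (LEAST n. P n)"
  have "\<exists>n. P n" using assms(3,4) unfolding reach_def P_def by blast
  then have "P k" unfolding k_def by (rule LeastI_ex)
  have min: "k \<le> n" if "z \<in> ?L n" "z \<notin> M I" for n z
    using that unfolding k_def P_def by (intro Least_le) blast
  obtain z where z: "z \<in> ?L k" "z \<notin> M I" using \<open>P k\<close> unfolding P_def by blast
  from layer_path[OF z(1)] obtain x y where xy: "x k = z" "x 0 \<in> T" "\<forall>i\<le>k. x i \<in> ?L i"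
    and arc: "\<forall>i<k. y i \<in> I \<and> x i \<notin> M (I - {y i}) \<and> x (Suc i) \<in> N I \<and> x (Suc i) \<notin> N (I - {y i})"
    by blast
  have V: "\<forall>i\<le>k. x i \<in> V - I" using xy(3) layer_subset[OF T(1)] by blast
  have end_: "k \<le> m + d" if "x j \<in> ?L m" "j + d = k" for j m d
    using layer_shift[OF V arc that(1), of d] that(2) xy(1) z(2) min by auto
  have early: "x i \<in> M I" if "i < k" for i
    using min[of "x i" i] xy(3) that by auto
  have M: "x i \<in> M (I - {y j})" if ij: "i < j" "j < k" for i j
  proof (rule ccontr)
    assume "x i \<notin> M (I - {y j})"
    then have "x (Suc j) \<in> ?L (Suc i)"
      by (intro layer_SucI[of "x i" _ _ _ _ _ _ "y j"]) (use ij arc xy(3) V in auto)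
    from end_[OF this, of "k - Suc j"] ij show False by simp
  qed
  have N: "x (Suc j) \<in> N (I - {y i})" if ij: "i < j" "j < k" for i j
  proof (rule ccontr)
    assume "x (Suc j) \<notin> N (I - {y i})"
    then have "x (Suc j) \<in> ?L (Suc i)"
      by (intro layer_SucI[of "x i" _ _ _ _ _ _ "y i"]) (use ij arc xy(3) V in auto)
    from end_[OF this, of "k - Suc j"] ij show False by simp
  qed
  have "augmenting_path M N V I x y k"
    unfolding augmenting_path_def using V arc early M N xy(1,2) z(2) T(2) by blast
  then show ?thesis using xy(2) by blast
qed

locale closure_pair = M: closure_matroid M + N: closure_matroid N
  for M N :: "'a set \<Rightarrow> 'a set"
begin

text \<open>In \<open>N\<close> the exchanges pair \<open>y i\<close> with \<open>x (Suc i)\<close>;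
  the remaining \<open>x 0\<close> lies outside \<open>N I\<close> and is added last.\<close>

lemma flip_N:
  assumes I: "cindep N I" and p: "augmenting_path M N V I x y k"
  shows "cindep N (flip I x y k)" "N (flip I x y k) = N (insert (x 0) I)"
proof -
  have "cindep N (I - y ` {..<k} \<union> (\<lambda>i. x (Suc i)) ` {..<k}) \<and>
      N (I - y ` {..<k} \<union> (\<lambda>i. x (Suc i)) ` {..<k}) = N I"
    by (rule N.triangular_swap[OF I]) (use p in \<open>auto simp: augmenting_path_def\<close>)
  moreover have "flip I x y k = insert (x 0) (I - y ` {..<k} \<union> (\<lambda>i. x (Suc i)) ` {..<k})"
    unfolding flip_def by (auto simp: image_iff) (metis Suc_le_eq Suc_pred lessThan_iff not_gr_zero)+
  moreover have "x 0 \<notin> N I" using p unfolding augmenting_path_def by blast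
  ultimately show "cindep N (flip I x y k)" "N (flip I x y k) = N (insert (x 0) I)"
    using N.cindep_insert N.cl_Un_cl by (simp, metis N.cl_Un_cl insert_is_Un)
qed

lemma flip_M:
  assumes I: "cindep M I" and p: "augmenting_path M N V I x y k"
  shows "cindep M (flip I x y k)" "M (flip I x y k) = M (insert (x k) I)"
proof -
  \<comment> \<open>In \<open>M\<close> the exchanges pair \<open>y i\<close> with
    \<open>x i\<close>, and they are triangular in decreasing order of \<open>i\<close>;
    \<open>r\<close> reverses the indices.\<close>
  define r where "r i = k - Suc i" for i
  have r: "r ` {..<k} = {..<k}"
  proof
    show "{..<k} \<subseteq> r ` {..<k}"
    proof
      fix i assume "i \<in> {..<k}"
      then show "i \<in> r ` {..<k}" unfolding r_def by (intro image_eqI[of _ _ "k - Suc i"]) auto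
    qed
  qed (auto simp: r_def)
  have lt: "r i < k" if "i < k" for i using that unfolding r_def by simp
  have anti: "r j < r i" if "i < j" "j < k" for i j using that unfolding r_def by simp
  have mem: "(y \<circ> r) i \<in> I \<and> (x \<circ> r) i \<notin> I \<and> (x \<circ> r) i \<in> M I \<and> (x \<circ> r) i \<notin> M (I - {(y \<circ> r) i})"
    if "i < k" for i
    using p lt[OF that] unfolding augmenting_path_def by auto
  have tri: "(x \<circ> r) j \<in> M (I - {(y \<circ> r) i})" if "i < j" "j < k" for i j
    using p anti[OF that] lt[of i] that unfolding augmenting_path_def by auto
  have "cindep M (I - (y \<circ> r) ` {..<k} \<union> (x \<circ> r) ` {..<k}) \<and>
      M (I - (y \<circ> r) ` {..<k} \<union> (x \<circ> r) ` {..<k}) = M I"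
    by (rule M.triangular_swap[OF I mem tri])
  then have "cindep M (I - y ` {..<k} \<union> x ` {..<k}) \<and> M (I - y ` {..<k} \<union> x ` {..<k}) = M I"
    by (simp only: image_comp[symmetric] r)
  moreover have "flip I x y k = insert (x k) (I - y ` {..<k} \<union> x ` {..<k})"
    unfolding flip_def by (auto simp: lessThan_Suc_atMost[symmetric] lessThan_Suc)
  moreover have "x k \<notin> M I" using p unfolding augmenting_path_def by blast
  ultimately show "cindep M (flip I x y k)" "M (flip I x y k) = M (insert (x k) I)"
    using M.cindep_insert by (simp, metis M.cl_Un_cl insert_is_Un)
qed

lemma flip_subset: "I \<subseteq> V \<Longrightarrow> augmenting_path M N V I x y k \<Longrightarrow> flip I x y k \<subseteq> V"
  unfolding flip_def augmenting_path_def by auto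

lemma region_spanned:
  assumes "cindep M I" "reach M N V I T \<subseteq> M I"
  shows "region M N V I T \<subseteq> M (I \<inter> region M N V I T)"
proof
  let ?R = "region M N V I T"
  fix z assume z: "z \<in> ?R"
  show "z \<in> M (I \<inter> ?R)"
  proof (cases "z \<in> reach M N V I T")
    case True
    then have "z \<in> M {y \<in> I. z \<notin> M (I - {y})}" using assms by (intro M.fundamental) auto
    moreover have "{y \<in> I. z \<notin> M (I - {y})} \<subseteq> I \<inter> ?R" using True unfolding region_def by auto
    ultimately show ?thesis using M.mono by (meson subsetD)
  next
    case False
    then have "z \<in> I \<inter> ?R" using z unfolding region_def by auto
    then show ?thesis using M.ext by (meson subsetD)
  qed
qed

text \<open>If the \<open>N\<close>-circuit of \<open>z\<close> met the region in some
  \<open>y\<close>, an exchange through \<open>y\<close> would reach \<open>z\<close>.\<close>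

lemma outside_region_spanned:
  assumes I: "cindep N I" and T: "T \<subseteq> V - I" and z: "z \<in> V" "z \<in> N I" "z \<notin> region M N V I T"
  shows "z \<in> N (I - region M N V I T)"
proof (cases "z \<in> I")
  case True
  then have "z \<in> I - region M N V I T" using z by simp
  then show ?thesis using N.ext by (meson subsetD)
next
  case False
  let ?R = "region M N V I T"
  have "{y \<in> I. z \<notin> N (I - {y})} \<subseteq> I - ?R"
  proof
    fix y assume y: "y \<in> {y \<in> I. z \<notin> N (I - {y})}"
    have "y \<notin> ?R"
    proof
      assume "y \<in> ?R"
      then obtain x where x: "x \<in> reach M N V I T" "x \<notin> M (I - {y})"
        using y reach_subset[OF T, of M N] unfolding region_def by blast
      have "z \<in> reach M N V I T" using reach_step[OF x(1) _ x(2)] y z False by simp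
      then show False using z(3) unfolding region_def by simp
    qed
    then show "y \<in> I - ?R" using y by simp
  qed
  then show ?thesis using N.fundamental[OF I z(2)] N.mono by (meson subsetD)
qed

text \<open>A path that meets the region stays reachable up to its end \<open>x k\<close>, which is
  outside \<open>M I\<close>; hence the induction backwards from \<open>k\<close>.\<close>

lemma path_avoids_region:
  assumes p: "augmenting_path M N V I x y k" and T: "T \<subseteq> V - I" and R: "reach M N V I T \<subseteq> M I"
  shows "i \<le> k \<Longrightarrow> x i \<notin> region M N V I T" "i < k \<Longrightarrow> y i \<notin> region M N V I T"
proof -
  let ?R = "reach M N V I T"
  have end_: "x k \<notin> ?R" using p R unfolding augmenting_path_def by blast
  have step: "x (Suc i) \<in> ?R" if "i < k" "u \<in> ?R" "u \<notin> M (I - {y i})" for i u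
    by (rule reach_step[OF that(2) _ that(3)]) (use p that in \<open>auto simp: augmenting_path_def\<close>)
  have x: "x i \<notin> ?R" if "i \<le> k" for i
    using that
  proof (induction "k - i" arbitrary: i)
    case 0
    then show ?case using end_ by simp
  next
    case (Suc n)
    then have "x (Suc i) \<notin> ?R" by simp
    then show ?case using step[of i "x i"] Suc p unfolding augmenting_path_def by force
  qed
  show "x i \<notin> region M N V I T" if "i \<le> k"
    using x[OF that] p that unfolding region_def augmenting_path_def by blast
  show "y i \<notin> region M N V I T" if "i < k"
  proof
    assume "y i \<in> region M N V I T"
    moreover have "y i \<in> I" using p that unfolding augmenting_path_def by blast
    ultimately obtain u where "u \<in> ?R" "u \<notin> M (I - {y i})"
      using reach_subset[OF T, of M N] unfolding region_def by blast
    then show False using step[OF that] x[of "Suc i"] that by simp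
  qed
qed

end

section \<open>Counting finite changes, and solutions in the absence of augmenting paths\<close>

context exchange_closure
begin

lemma cindep_split: "cindep cl (A \<union> D) \<Longrightarrow> A \<inter> D = {} \<Longrightarrow> cindep (contr cl D) A"
  unfolding cindep_def contr_def
proof
  fix x assume *: "\<forall>x\<in>A \<union> D. x \<notin> cl (A \<union> D - {x})" "A \<inter> D = {}" "x \<in> A"
  then have "A - {x} \<union> D = A \<union> D - {x}" by blast
  then show "x \<notin> cl (A - {x} \<union> D)" using * by simp
qed

text \<open>Contracting the common part \<open>K \<inter> J\<close> leaves a finite problem even
  when \<open>J\<close> and \<open>K\<close> are infinite.\<close>

lemma steinitz_diff:
  assumes "cindep cl J" "J \<subseteq> cl (K \<union> A)" "finite A" "finite (K - J)"
  shows "finite (J - K) \<and> card (J - K) \<le> card (K - J) + card A"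
proof -
  have "J - K \<union> K \<inter> J = J" "(K - J) \<union> A \<union> K \<inter> J = K \<union> A" by blast+
  then have "cindep (contr cl (K \<inter> J)) (J - K)" "J - K \<subseteq> contr cl (K \<inter> J) ((K - J) \<union> A)"
    using assms(1,2) cindep_split[of "J - K" "K \<inter> J"] unfolding contr_def by auto
  from steinitz[OF _ exchange_closure_contr this]
  have "finite (J - K) \<and> card (J - K) \<le> card ((K - J) \<union> A)" using assms by simp
  then show ?thesis using card_Un_le[of "K - J" A] by linarith
qed

end

text \<open>Signed sizes of differences add up to zero around the triangle. The sets may be
  infinite, so the counting takes place in the finite set \<open>U\<close> of disagreements.\<close>

lemma card_diff_cycle:
  assumes "finite (A - B)" "finite (B - A)" "finite (B - C)" "finite (C - B)"
  shows "card (A - B) + card (B - C) + card (C - A) = card (B - A) + card (C - B) + card (A - C)"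
proof -
  define U where "U = (A - B) \<union> (B - A) \<union> (B - C) \<union> (C - B)"
  have U: "finite U" using assms unfolding U_def by simp
  have *: "card (X \<inter> U) + card (Y - X) = card (Y \<inter> U) + card (X - Y)"
    if "X - Y \<subseteq> U" "Y - X \<subseteq> U" for X Y
  proof -
    have "X \<inter> U \<union> (Y - X) = Y \<inter> U \<union> (X - Y)" using that by blast
    moreover have "card (X \<inter> U \<union> (Y - X)) = card (X \<inter> U) + card (Y - X)"
      using U that by (intro card_Un_disjoint) (auto intro: finite_subset)
    moreover have "card (Y \<inter> U \<union> (X - Y)) = card (Y \<inter> U) + card (X - Y)"
      using U that by (intro card_Un_disjoint) (auto intro: finite_subset)
    ultimately show ?thesis by simp
  qed
  have "card (A \<inter> U) + card (B - A) = card (B \<inter> U) + card (A - B)"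
    "card (B \<inter> U) + card (C - B) = card (C \<inter> U) + card (B - C)"
    "card (C \<inter> U) + card (A - C) = card (A \<inter> U) + card (C - A)"
    by (rule *; use U_def in blast)+
  then show ?thesis by linarith
qed

text \<open>
  The intersection property in terms of closure operators. Only the spanning sets \<open>A\<close> and \<open>D\<close> that
  are independent over the other side are recorded, which makes the notion self-dual.
\<close>

definition split_solution :: "'a set \<Rightarrow> ('a set \<Rightarrow> 'a set) \<Rightarrow> ('a set \<Rightarrow> 'a set) \<Rightarrow> bool" where
  "split_solution E M N \<longleftrightarrow> (\<exists>E\<^sub>M E\<^sub>N A D. E = E\<^sub>M \<union> E\<^sub>N \<and> E\<^sub>M \<inter> E\<^sub>N = {} \<and>
    A \<subseteq> E\<^sub>M \<and> E\<^sub>M \<subseteq> M A \<and> cindep (contr N E\<^sub>N) A \<and>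
    D \<subseteq> E\<^sub>N \<and> E\<^sub>N \<subseteq> N D \<and> cindep (contr M E\<^sub>M) D)"

lemma split_solutionI:
  "\<lbrakk>E = E\<^sub>M \<union> E\<^sub>N; E\<^sub>M \<inter> E\<^sub>N = {}; A \<subseteq> E\<^sub>M; E\<^sub>M \<subseteq> M A; cindep (contr N E\<^sub>N) A;
    D \<subseteq> E\<^sub>N; E\<^sub>N \<subseteq> N D; cindep (contr M E\<^sub>M) D\<rbrakk> \<Longrightarrow> split_solution E M N"
  unfolding split_solution_def by blast

lemma split_solution_sym: "split_solution E M N \<Longrightarrow> split_solution E N M"
  unfolding split_solution_def by (metis Un_commute Int_commute)

lemma augmenting_path_inj:
  assumes p: "augmenting_path M N V I x y k"
  shows "inj_on x {..k}" "inj_on y {..<k}"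
proof -
  have x: "x i \<noteq> x j" if "i < j" "j \<le> k" for i j
  proof (cases i)
    case 0
    have "j - 1 < k" "Suc (j - 1) = j" using that by auto
    then show ?thesis using p 0 unfolding augmenting_path_def by metis
  next
    case (Suc i')
    have "i' < j - 1" "j - 1 < k" "Suc (j - 1) = j" using Suc that by auto
    then show ?thesis using p Suc unfolding augmenting_path_def
      by (metis order.strict_trans)
  qed
  have y: "y i \<noteq> y j" if "i < j" "j < k" for i j
    using p that unfolding augmenting_path_def by (metis order.strict_trans)
  show "inj_on x {..k}" unfolding inj_on_def using x by (metis atMost_iff linorder_neqE_nat)
  show "inj_on y {..<k}" unfolding inj_on_def using y by (metis lessThan_iff linorder_neqE_nat)
qed

lemma flip_diff:
  assumes p: "augmenting_path M N V I x y k"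
  shows "finite (flip I x y k - I)" "card (flip I x y k - I) = Suc k"
    "finite (I - flip I x y k)" "card (I - flip I x y k) = k"
proof -
  have "x ` {..k} \<inter> I = {}" "y ` {..<k} \<subseteq> I" using p unfolding augmenting_path_def by auto
  then have "flip I x y k - I = x ` {..k}" "I - flip I x y k = y ` {..<k}" unfolding flip_def by auto
  then show "finite (flip I x y k - I)" "card (flip I x y k - I) = Suc k"
    "finite (I - flip I x y k)" "card (I - flip I x y k) = k"
    using augmenting_path_inj[OF p] by (auto simp: card_image)
qed

context closure_pair
begin

text \<open>Without a path everything reached from \<open>T\<close> lies in \<open>M I\<close>, so
  the region is spanned in \<open>M\<close> by its part of \<open>I\<close>. Its complement contains
  nothing of \<open>T\<close> and is spanned in \<open>N\<close> by the rest of
  \<open>I\<close>.\<close>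

lemma no_augmenting_path_split_solution:
  assumes I: "I \<subseteq> E" "cindep M I" "cindep N I"
    and no: "\<And>x y k. \<not> augmenting_path M N E I x y k"
  shows "split_solution E M N"
proof -
  define T where "T = E - N I"
  have T: "T \<subseteq> E - I" "T \<inter> N I = {}" unfolding T_def using N.ext[of I] by auto
  have R: "reach M N E I T \<subseteq> M I" using augmenting_path_exists[of T E I N _ M] T no by blast
  define R where "R = region M N E I T"
  have sub: "R \<subseteq> E" unfolding R_def by (rule region_subset[OF T(1) I(1)])
  have 1: "R \<subseteq> M (I \<inter> R)" unfolding R_def by (rule region_spanned[OF I(2) R])
  have 2: "E - R \<subseteq> N (I - R)"
  proof
    fix z assume z: "z \<in> E - R"
    then have "z \<in> N I" using T_subset_reach[of T M N E I] unfolding R_def region_def T_def by auto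
    then show "z \<in> N (I - R)" using outside_region_spanned[OF I(3) T(1), of z] z unfolding R_def by blast
  qed
  have 3: "I \<inter> R \<union> (I - R) = I" "(I - R) \<union> I \<inter> R = I" "I \<inter> R \<inter> (I - R) = {}" "(I - R) \<inter> (I \<inter> R) = {}"
    by auto
  \<comment> \<open>The two parts of \<open>I\<close> are independent over each other, hence over
    the sides that they span.\<close>
  have "cindep (contr N (I - R)) (I \<inter> R)" by (rule N.cindep_split) (use 3 I in auto)
  then have 4: "cindep (contr N (E - R)) (I \<inter> R)" by (rule N.cindep_contr_mono) (rule 2)
  have "cindep (contr M (I \<inter> R)) (I - R)" by (rule M.cindep_split) (use 3 I in auto)
  then have 5: "cindep (contr M R) (I - R)" by (rule M.cindep_contr_mono) (rule 1)
  show ?thesis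
    by (rule split_solutionI[OF _ _ _ 1 4 _ 2 5]) (use sub I in auto)
qed

text \<open>
  A common independent set with maximal gain over \<open>I\<close> admits no augmenting path; the gain is bounded
  by the sizes of \<open>A\<close> and \<open>D\<close>.
\<close>

lemma finite_defect_split_solution:
  assumes I: "I \<subseteq> E" "cindep M I" "cindep N I"
    and E: "E = E\<^sub>M \<union> E\<^sub>N" "E\<^sub>M \<inter> E\<^sub>N = {}"
    and A: "finite A" "E\<^sub>M \<subseteq> M (I \<inter> E\<^sub>M \<union> A)" and D: "finite D" "E\<^sub>N \<subseteq> N (I \<inter> E\<^sub>N \<union> D)"
  shows "split_solution E M N"
proof -
  define S where "S J \<longleftrightarrow> J \<subseteq> E \<and> cindep M J \<and> cindep N J \<and> finite (J - I) \<and> finite (I - J)" for J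
  define c where "c = card A + card D"
  \<comment> \<open>The constant \<open>c\<close> turns maximal gain into a least natural number; by
    \<open>bound\<close> the subtraction does not truncate on sets satisfying
    \<open>S\<close>.\<close>
  define defect where "defect J = c + card (I - J) - card (J - I)" for J
  have bound: "card (J - I) \<le> c + card (I - J)" if J: "S J" for J
  proof -
    let ?J = "J \<inter> E\<^sub>M" and ?K = "I \<inter> E\<^sub>M" and ?J' = "J \<inter> E\<^sub>N" and ?K' = "I \<inter> E\<^sub>N"
    have fin: "finite (J - I)" "finite (I - J)" and JE: "J \<subseteq> E" "I \<subseteq> E"
      using J I unfolding S_def by auto
    have "cindep M ?J" "cindep N ?J'" "finite (?K - ?J)" "finite (?K' - ?J')"
      using J M.cindep_subset[of J ?J] N.cindep_subset[of J ?J'] unfolding S_def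
      by (auto intro: finite_subset[of _ "I - J"])
    then have 1: "card (?J - ?K) \<le> card (?K - ?J) + card A" "card (?J' - ?K') \<le> card (?K' - ?J') + card D"
      using A D M.steinitz_diff[of ?J ?K A] N.steinitz_diff[of ?J' ?K' D] by auto
    have eq: "J - I = (?J - ?K) \<union> (?J' - ?K')" "I - J = (?K - ?J) \<union> (?K' - ?J')"
      using JE E by auto
    have "card ((?J - ?K) \<union> (?J' - ?K')) = card (?J - ?K) + card (?J' - ?K')"
      using E by (intro card_Un_disjoint) (auto intro: finite_subset[OF _ fin(1)])
    moreover have "card ((?K - ?J) \<union> (?K' - ?J')) = card (?K - ?J) + card (?K' - ?J')"
      using E by (intro card_Un_disjoint) (auto intro: finite_subset[OF _ fin(2)])
    ultimately show ?thesis unfolding c_def eq using 1 by linarith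
  qed
  have "S I" unfolding S_def using I by simp
  from ex_has_least_nat[of S, OF this, of defect]
  obtain J where J: "S J" and min: "\<And>J'. S J' \<Longrightarrow> defect J \<le> defect J'" by blast
  have JJ: "J \<subseteq> E" "cindep M J" "cindep N J" using J unfolding S_def by auto
  show ?thesis
  proof (rule no_augmenting_path_split_solution[OF JJ])
    fix x y k
    show "\<not> augmenting_path M N E J x y k"
    proof
      assume p: "augmenting_path M N E J x y k"
      let ?F = "flip J x y k"
      note d = flip_diff[OF p]
      have f: "finite (J - I)" "finite (I - J)" using J unfolding S_def by auto
      have "?F - I \<subseteq> (?F - J) \<union> (J - I)" "I - ?F \<subseteq> (I - J) \<union> (J - ?F)" by auto
      then have "finite (?F - I)" "finite (I - ?F)" using d f by (auto intro: finite_subset)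
      then have F: "S ?F"
        unfolding S_def using flip_subset[OF JJ(1) p] flip_M[OF JJ(2) p] flip_N[OF JJ(3) p] by blast
      \<comment> \<open>The flip adds \<open>k + 1\<close> elements and removes \<open>k\<close>, so
        the defect would drop by one.\<close>
      have "card (?F - J) + card (J - I) + card (I - ?F) = card (J - ?F) + card (I - J) + card (?F - I)"
        by (rule card_diff_cycle) (use d f in auto)
      then show False using min[OF F] bound[OF F] bound[OF J] d unfolding defect_def by linarith
    qed
  qed
qed

end

section \<open>Closure operators of infinite matroids\<close>

text \<open>Total on the type: an element outside \<open>E\<close> is spanned only by sets
  containing it, so it acts as a coloop.\<close>

definition mcl :: "'a set \<Rightarrow> 'a set set \<Rightarrow> 'a set \<Rightarrow> 'a set" where
  "mcl E \<I> X = {e. spans E \<I> X e}"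

lemma mcl_ext: "X \<subseteq> mcl E \<I> X"
  unfolding mcl_def spans_def by blast

lemma mcl_mono: "X \<subseteq> Y \<Longrightarrow> mcl E \<I> X \<subseteq> mcl E \<I> Y"
  unfolding mcl_def spans_def by blast

lemma mcl_iff_ground: "e \<in> mcl E \<I> X \<longleftrightarrow> e \<in> X \<or> e \<in> E \<and> e \<in> mcl E \<I> (X \<inter> E)"
proof -
  have "C \<subseteq> E" if "C \<in> circuits E \<I>" for C using that unfolding circuits_def by simp
  then show ?thesis unfolding mcl_def spans_def by blast
qed

context matroid
begin

text \<open>Given a circuit through \<open>e\<close> in \<open>X + e\<close>, its remainder extends
  to a maximal independent \<open>K\<close> in \<open>X\<close>, which stays maximal in
  \<open>X + e\<close>. If \<open>J + e\<close> were independent, restricted exchange with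
  \<open>K\<close> would enlarge \<open>J\<close> inside \<open>X\<close>.\<close>

lemma mcl_iff_base:
  assumes X: "X \<subseteq> E" and J: "maximal_in (\<I> \<inter> Pow X) J" and e: "e \<in> E"
  shows "e \<in> mcl E \<I> X \<longleftrightarrow> e \<in> J \<or> insert e J \<notin> \<I>"
proof
  have Ji: "J \<in> \<I>" "J \<subseteq> X" using maximal_inD(1)[OF J] by auto
  assume "e \<in> J \<or> insert e J \<notin> \<I>"
  then show "e \<in> mcl E \<I> X"
  proof
    assume n: "insert e J \<notin> \<I>"
    have "insert e J \<subseteq> E" using Ji X e by blast
    then obtain C where C: "C \<in> circuits E \<I>" "C \<subseteq> insert e J"
      using dependent_contains_circuit n by blast
    have "C \<notin> \<I>" using C unfolding circuits_def by blast
    then have "e \<in> C" using indep_subset[OF Ji(1), of C] C by blast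
    then show ?thesis using C Ji unfolding mcl_def spans_def by blast
  qed (use Ji mcl_ext[of X] in blast)
next
  have Ji: "J \<in> \<I>" "J \<subseteq> X" using maximal_inD(1)[OF J] by auto
  assume c: "e \<in> mcl E \<I> X"
  show "e \<in> J \<or> insert e J \<notin> \<I>"
  proof (rule ccontr)
    assume n: "\<not> ?thesis"
    then have "e \<notin> X" using maximal_in_eqI[OF J, of e] Ji by blast
    then obtain C where C: "C \<in> circuits E \<I>" "e \<in> C" "C - {e} \<subseteq> X"
      using c unfolding mcl_def spans_def by blast
    have "C - {e} \<in> \<I>" using C unfolding circuits_def by blast
    then obtain K where K: "C - {e} \<subseteq> K" "maximal_in (\<I> \<inter> Pow X) K"
      using extend[OF X, of "C - {e}"] C by blast
    have Ki: "K \<in> \<I>" "K \<subseteq> X" using maximal_inD(1)[OF K(2)] by auto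
    have eK: "insert e K \<notin> \<I>"
    proof
      assume "insert e K \<in> \<I>"
      then have "C \<in> \<I>" by (rule indep_subset) (use K in blast)
      then show False using C unfolding circuits_def by blast
    qed
    have "maximal_in (\<I> \<inter> Pow (insert e X)) K"
    proof -
      have "Y = K" if Y: "Y \<in> \<I>" "Y \<subseteq> insert e X" "K \<subseteq> Y" for Y
      proof -
        have "e \<notin> Y" using eK indep_subset[OF Y(1), of "insert e K"] Y by blast
        then show ?thesis using maximal_inD(2)[OF K(2), of Y] Y by blast
      qed
      then show ?thesis using Ki unfolding maximal_in_def by blast
    qed
    moreover have "insert e X \<subseteq> E" "e \<in> insert e X" "J \<subseteq> insert e X" using X e Ji by auto
    ultimately obtain f where f: "f \<in> K - J" "insert f J \<in> \<I>"
      using augment_restrict[of "insert e X" K J e] Ji(1) n by blast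
    then have "f \<in> J" using maximal_in_eqI[OF J, of f] Ji Ki by blast
    then show False using f by blast
  qed
qed

lemma maximal_in_mcl:
  assumes X: "X \<subseteq> E" and J: "maximal_in (\<I> \<inter> Pow X) J" and Y: "X \<subseteq> Y" "Y \<subseteq> mcl E \<I> X" "Y \<subseteq> E"
  shows "maximal_in (\<I> \<inter> Pow Y) J"
proof -
  have Ji: "J \<in> \<I>" "J \<subseteq> X" using maximal_inD(1)[OF J] by auto
  have "Z = J" if Z: "Z \<in> \<I>" "Z \<subseteq> Y" "J \<subseteq> Z" for Z
  proof -
    have "z \<in> J" if z: "z \<in> Z" for z
    proof -
      have "insert z J \<in> \<I>" by (rule indep_subset[OF Z(1)]) (use Z z in blast)
      then show ?thesis using mcl_iff_base[OF X J, of z] Y Z z by blast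
    qed
    then show ?thesis using Z by blast
  qed
  then show ?thesis using Ji Y unfolding maximal_in_def by blast
qed

text \<open>For \<open>J\<close> maximal independent in \<open>X\<close> and distinct
  \<open>e\<close>, \<open>f\<close> not spanned by \<open>X\<close>, each side of the exchange
  property says that \<open>J + e + f\<close> is dependent. Idempotence holds because
  \<open>J\<close> stays maximal in sets between \<open>X\<close> and its closure.\<close>

lemma exchange_closure_mcl: "exchange_closure (mcl E \<I>)"
proof
  show "X \<subseteq> mcl E \<I> X" for X by (rule mcl_ext)
  show "mcl E \<I> X \<subseteq> mcl E \<I> Y" if "X \<subseteq> Y" for X Y by (rule mcl_mono[OF that])
  have base: "\<exists>J. maximal_in (\<I> \<inter> Pow X) J" if "X \<subseteq> E" for X
    using extend[OF that, of "{}"] empty_indep by blast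
  have idem: "mcl E \<I> Y \<subseteq> mcl E \<I> X" if XY: "X \<subseteq> E" "X \<subseteq> Y" "Y \<subseteq> E" "Y \<subseteq> mcl E \<I> X" for X Y
  proof
    fix e assume e: "e \<in> mcl E \<I> Y"
    then have eE: "e \<in> E" using mcl_iff_ground[of e E \<I> Y] XY(3) by blast
    obtain J where J: "maximal_in (\<I> \<inter> Pow X) J" using base[OF XY(1)] by blast
    have "maximal_in (\<I> \<inter> Pow Y) J" by (rule maximal_in_mcl[OF XY(1) J XY(2,4,3)])
    then show "e \<in> mcl E \<I> X" using mcl_iff_base[OF _ _ eE] J XY e by metis
  qed
  show "mcl E \<I> (mcl E \<I> X) = mcl E \<I> X" for X
  proof
    show "mcl E \<I> X \<subseteq> mcl E \<I> (mcl E \<I> X)" by (rule mcl_ext)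
    show "mcl E \<I> (mcl E \<I> X) \<subseteq> mcl E \<I> X"
    proof
      fix e assume "e \<in> mcl E \<I> (mcl E \<I> X)"
      then consider "e \<in> mcl E \<I> X" | "e \<in> E" "e \<in> mcl E \<I> (mcl E \<I> X \<inter> E)"
        using mcl_iff_ground[of e E \<I> "mcl E \<I> X"] by blast
      then show "e \<in> mcl E \<I> X"
      proof cases
        case 2
        have "mcl E \<I> X \<inter> E \<subseteq> mcl E \<I> (X \<inter> E)"
          using mcl_iff_ground[of _ E \<I> X] mcl_ext[of "X \<inter> E" E \<I>] by blast
        moreover have "X \<inter> E \<subseteq> mcl E \<I> X \<inter> E" using mcl_ext[of X E \<I>] by blast
        ultimately have "mcl E \<I> (mcl E \<I> X \<inter> E) \<subseteq> mcl E \<I> (X \<inter> E)" by (intro idem) auto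
        then show ?thesis using 2 mcl_iff_ground[of e E \<I> X] by blast
      qed
    qed
  qed
  show "f \<in> mcl E \<I> (insert e X)" if ef: "e \<in> mcl E \<I> (insert f X)" "e \<notin> mcl E \<I> X" for e f X
  proof (cases "e = f")
    case False
    let ?X = "X \<inter> E"
    have nX: "e \<notin> X" "e \<notin> mcl E \<I> ?X"
      using ef mcl_ext[of X E \<I>] mcl_mono[of ?X X E \<I>] by auto
    then have eE: "e \<in> E" and ef': "e \<in> mcl E \<I> (insert f X \<inter> E)"
      using mcl_iff_ground[of e E \<I> "insert f X"] ef False by auto
    have fE: "f \<in> E"
    proof (rule ccontr)
      assume "f \<notin> E"
      then have "insert f X \<inter> E = ?X" by blast
      then show False using ef' nX by simp
    qed
    then have ef'': "e \<in> mcl E \<I> (insert f ?X)" using ef' by simp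
    obtain J where J: "maximal_in (\<I> \<inter> Pow ?X) J" using base by blast
    have Ji: "J \<in> \<I>" "J \<subseteq> ?X" using maximal_inD(1)[OF J] by auto
    have eJ: "e \<notin> J" "insert e J \<in> \<I>" using mcl_iff_base[OF _ J eE] nX by auto
    have fn: "f \<notin> mcl E \<I> ?X"
    proof
      assume "f \<in> mcl E \<I> ?X"
      then have "insert f ?X \<subseteq> mcl E \<I> ?X" using mcl_ext[of ?X E \<I>] by blast
      then have "mcl E \<I> (insert f ?X) \<subseteq> mcl E \<I> ?X" using fE by (intro idem) auto
      then show False using ef'' nX by blast
    qed
    have max: "maximal_in (\<I> \<inter> Pow (insert z ?X)) (insert z J)"
      if z: "z \<in> E" "z \<notin> J" "insert z J \<in> \<I>" for z
    proof -
      have "Y = insert z J" if Y: "Y \<in> \<I>" "Y \<subseteq> insert z ?X" "insert z J \<subseteq> Y" for Y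
      proof -
        have "y \<in> J" if y: "y \<in> Y" "y \<noteq> z" for y
        proof -
          have "insert y J \<in> \<I>" by (rule indep_subset[OF Y(1)]) (use Y y in blast)
          then show ?thesis using maximal_in_eqI[OF J, of y] Ji Y y by blast
        qed
        then show ?thesis using Y by blast
      qed
      then show ?thesis using z Ji unfolding maximal_in_def by blast
    qed
    have fJ: "f \<notin> J" "insert f J \<in> \<I>" using mcl_iff_base[OF _ J fE] fn by auto
    have "insert e (insert f J) \<notin> \<I>"
      using mcl_iff_base[OF _ max[OF fE fJ] eE] ef'' eJ False fE by auto
    then have "f \<in> mcl E \<I> (insert e ?X)"
      using mcl_iff_base[OF _ max[OF eE eJ] fE] eE by (auto simp: insert_commute)
    then show ?thesis using mcl_mono[of "insert e ?X" "insert e X" E \<I>] by blast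
  qed (use mcl_ext[of "insert e X" E \<I>] in blast)
qed

lemma cindep_mcl_iff: "cindep (mcl E \<I>) I \<longleftrightarrow> I \<inter> E \<in> \<I>"
proof -
  have ne: "C \<noteq> {}" if "C \<in> circuits E \<I>" for C
    using that empty_indep unfolding circuits_def by auto
  have "cindep (mcl E \<I>) I \<longleftrightarrow> \<not> (\<exists>C\<in>circuits E \<I>. C \<subseteq> I)"
  proof
    assume i: "cindep (mcl E \<I>) I"
    show "\<not> (\<exists>C\<in>circuits E \<I>. C \<subseteq> I)"
    proof
      assume "\<exists>C\<in>circuits E \<I>. C \<subseteq> I"
      then obtain C where C: "C \<in> circuits E \<I>" "C \<subseteq> I" by blast
      then obtain x where "x \<in> C" using ne by blast
      with C have "x \<in> mcl E \<I> (I - {x})" unfolding mcl_def spans_def by blast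
      then show False using i C \<open>x \<in> C\<close> unfolding cindep_def by blast
    qed
  next
    assume n: "\<not> (\<exists>C\<in>circuits E \<I>. C \<subseteq> I)"
    show "cindep (mcl E \<I>) I"
      unfolding cindep_def
    proof
      fix x assume "x \<in> I"
      then show "x \<notin> mcl E \<I> (I - {x})" using n unfolding mcl_def spans_def by blast
    qed
  qed
  also have "\<dots> \<longleftrightarrow> \<not> (\<exists>C\<in>circuits E \<I>. C \<subseteq> I \<inter> E)"
  proof -
    have "C \<subseteq> E" if "C \<in> circuits E \<I>" for C using that unfolding circuits_def by simp
    then show ?thesis by blast
  qed
  finally show ?thesis by (simp only: indep_iff_no_circuit[of "I \<inter> E"] Int_lower2 simp_thms)
qed

lemma cindep_mcl: "I \<subseteq> E \<Longrightarrow> cindep (mcl E \<I>) I \<longleftrightarrow> I \<in> \<I>"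
  by (simp add: cindep_mcl_iff inf_absorb1)

lemma closure_matroid_mcl: "closure_matroid (mcl E \<I>)"
proof -
  interpret exchange_closure "mcl E \<I>" by (rule exchange_closure_mcl)
  show ?thesis
  proof
    fix I X assume I: "cindep (mcl E \<I>) I" "I \<subseteq> X"
    then have "I \<inter> E \<in> \<I>" by (simp add: cindep_mcl_iff)
    then obtain J where J: "I \<inter> E \<subseteq> J" "maximal_in (\<I> \<inter> Pow (X \<inter> E)) J"
      using extend[of "X \<inter> E" "I \<inter> E"] I by blast
    have Ji: "J \<in> \<I>" "J \<subseteq> X \<inter> E" using maximal_inD(1)[OF J(2)] by auto
    \<comment> \<open>Elements outside \<open>E\<close> are coloops and must all be taken.\<close>
    let ?J = "J \<union> (X - E)"
    have "?J \<inter> E = J" using Ji by blast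
    then have "cindep (mcl E \<I>) ?J" using Ji by (simp add: cindep_mcl_iff)
    moreover have "x \<in> mcl E \<I> ?J" if x: "x \<in> X" for x
    proof (cases "x \<in> E")
      case True
      have "J \<in> \<I> \<inter> Pow J" using Ji by simp
      then have m: "maximal_in (\<I> \<inter> Pow J) J" unfolding maximal_in_def by blast
      have "x \<in> J \<or> insert x J \<notin> \<I>" using maximal_in_eqI[OF J(2), of x] Ji x True by blast
      then have "x \<in> mcl E \<I> J" using mcl_iff_base[OF _ m True] Ji by blast
      then show ?thesis using mono[of J ?J] by blast
    next
      case False
      then show ?thesis using x ext[of ?J] by blast
    qed
    ultimately show "\<exists>J. I \<subseteq> J \<and> J \<subseteq> X \<and> cindep (mcl E \<I>) J \<and> X \<subseteq> mcl E \<I> J"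
      using J Ji I by (intro exI[of _ ?J]) blast
  qed
qed

lemma bases_mcl_iff: "B \<in> bases \<I> \<longleftrightarrow> B \<in> \<I> \<and> E \<subseteq> mcl E \<I> B"
proof
  assume "B \<in> bases \<I>"
  then have B: "maximal_in \<I> B" unfolding bases_def by blast
  have Bi: "B \<in> \<I>" using B maximal_inD by blast
  then have m: "maximal_in (\<I> \<inter> Pow B) B" "B \<subseteq> E"
    using indep_in_ground unfolding maximal_in_def by auto
  have "e \<in> mcl E \<I> B" if "e \<in> E" for e
    using mcl_iff_base[OF m(2,1) that] maximal_in_eqI[OF B, of e] by blast
  then show "B \<in> \<I> \<and> E \<subseteq> mcl E \<I> B" using Bi by blast
next
  assume B: "B \<in> \<I> \<and> E \<subseteq> mcl E \<I> B"
  then have m: "maximal_in (\<I> \<inter> Pow B) B" "B \<subseteq> E"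
    using indep_in_ground unfolding maximal_in_def by auto
  have "Y = B" if Y: "Y \<in> \<I>" "B \<subseteq> Y" for Y
  proof -
    have "y \<in> B" if y: "y \<in> Y" for y
    proof -
      have "insert y B \<in> \<I>" by (rule indep_subset[OF Y(1)]) (use Y y in blast)
      moreover have "y \<in> E" using Y y indep_in_ground by blast
      ultimately show ?thesis using mcl_iff_base[OF m(2,1)] B by blast
    qed
    then show ?thesis using Y by blast
  qed
  then show "B \<in> bases \<I>" using B unfolding bases_def maximal_in_def by blast
qed

lemma dual_iff_spanning:
  assumes "X \<subseteq> E"
  shows "X \<in> dual E \<I> \<longleftrightarrow> E \<subseteq> mcl E \<I> (E - X)"
proof
  assume "X \<in> dual E \<I>"
  then obtain B where B: "B \<in> bases \<I>" "X \<subseteq> E - B" unfolding dual_def by blast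
  have "B \<subseteq> E" "E \<subseteq> mcl E \<I> B" using B bases_mcl_iff indep_in_ground by auto
  moreover from this have "mcl E \<I> B \<subseteq> mcl E \<I> (E - X)" using B by (intro mcl_mono) blast
  ultimately show "E \<subseteq> mcl E \<I> (E - X)" by blast
next
  assume s: "E \<subseteq> mcl E \<I> (E - X)"
  obtain J where J: "maximal_in (\<I> \<inter> Pow (E - X)) J"
    using extend[of "E - X" "{}"] empty_indep by blast
  have Ji: "J \<in> \<I>" "J \<subseteq> E - X" using maximal_inD(1)[OF J] by auto
  then have m: "maximal_in (\<I> \<inter> Pow J) J" "J \<subseteq> E" unfolding maximal_in_def by auto
  have "e \<in> mcl E \<I> J" if "e \<in> E" for e
    using mcl_iff_base[OF _ J that] mcl_iff_base[OF m(2,1) that] s that by blast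
  then have "J \<in> bases \<I>" using Ji bases_mcl_iff by blast
  then show "X \<in> dual E \<I>" using Ji assms unfolding dual_def by blast
qed

text \<open>With a maximal coindependent \<open>J\<close> in \<open>X\<close> in place of
  \<open>X\<close> this restates that coindependent sets have spanning complements. To pass to
  \<open>X\<close>, note that the fundamental circuit of \<open>e\<close> in a base of
  \<open>E - J - {e}\<close> avoids \<open>X\<close>: any \<open>y\<close> in \<open>X\<close> on it
  could be added to \<open>J\<close>.\<close>

lemma mcl_dual_iff:
  assumes X: "X \<subseteq> E" and e: "e \<in> E - X"
  shows "e \<in> mcl E (dual E \<I>) X \<longleftrightarrow> e \<notin> mcl E \<I> (E - X - {e})"
proof -
  interpret D: matroid E "dual E \<I>" by (rule matroid_dual)
  interpret closure_matroid "mcl E \<I>" by (rule closure_matroid_mcl)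
  obtain J where J: "maximal_in (dual E \<I> \<inter> Pow X) J"
    using D.extend[OF X, of "{}"] D.empty_indep by blast
  have Ji: "J \<in> dual E \<I>" "J \<subseteq> X" using maximal_inD(1)[OF J] by auto
  have sp: "E \<subseteq> mcl E \<I> (E - J)" using dual_iff_spanning[of J] Ji X by blast
  have drop: "E \<subseteq> mcl E \<I> (E - J - {x}) \<longleftrightarrow> x \<in> mcl E \<I> (E - J - {x})" if "x \<in> E" for x
  proof
    assume "x \<in> mcl E \<I> (E - J - {x})"
    then have "E - J \<subseteq> mcl E \<I> (E - J - {x})" using ext[of "E - J - {x}"] by blast
    then have "mcl E \<I> (E - J) \<subseteq> mcl E \<I> (E - J - {x})" by (rule cl_least)
    then show "E \<subseteq> mcl E \<I> (E - J - {x})" using sp by blast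
  qed (use that in blast)
  have ins: "insert x J \<in> dual E \<I> \<longleftrightarrow> x \<in> mcl E \<I> (E - J - {x})" if "x \<in> E" for x
  proof -
    have "insert x J \<subseteq> E" "E - insert x J = E - J - {x}" using Ji X that by auto
    then show ?thesis using dual_iff_spanning[of "insert x J"] drop[OF that] by simp
  qed
  have "e \<in> mcl E (dual E \<I>) X \<longleftrightarrow> e \<notin> mcl E \<I> (E - J - {e})"
    using D.mcl_iff_base[OF X J, of e] ins[of e] e Ji by blast
  also have "\<dots> \<longleftrightarrow> e \<notin> mcl E \<I> (E - X - {e})"
  proof -
    have "e \<in> mcl E \<I> (E - X - {e})" if a: "e \<in> mcl E \<I> (E - J - {e})"
    proof -
      obtain H where H: "H \<subseteq> E - J - {e}" "cindep (mcl E \<I>) H" "E - J - {e} \<subseteq> mcl E \<I> H"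
        using base[of "{}" "E - J - {e}"] by auto
      have "mcl E \<I> (E - J - {e}) \<subseteq> mcl E \<I> H" by (rule cl_least[OF H(3)])
      then have eH: "e \<in> mcl E \<I> H" using a by blast
      let ?C = "{y \<in> H. e \<notin> mcl E \<I> (H - {y})}"
      have "?C \<subseteq> E - X - {e}"
      proof
        fix y assume y: "y \<in> ?C"
        then have yE: "y \<in> E" using H by blast
        have "y \<notin> X"
        proof
          assume yX: "y \<in> X"
          have "y \<in> mcl E \<I> (insert e (H - {y}))"
            using exchange_remove[of y H e] y eH by blast
          moreover have "mcl E \<I> (insert e (H - {y})) \<subseteq> mcl E \<I> (E - J - {y})"
            using H e Ji yX by (intro mono) blast
          ultimately have "insert y J \<in> dual E \<I>" using ins[OF yE] by blast
          then have "y \<in> J" using maximal_in_eqI[OF J, of y] yX Ji by blast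
          then show False using y H by blast
        qed
        then show "y \<in> E - X - {e}" using y H by blast
      qed
      then show ?thesis using fundamental[OF H(2) eH] mono by (meson subsetD)
    qed
    moreover have "mcl E \<I> (E - X - {e}) \<subseteq> mcl E \<I> (E - J - {e})" by (rule mono) (use Ji in blast)
    ultimately show ?thesis by blast
  qed
  finally show ?thesis .
qed

lemma mcl_finitarization_subset: "mcl E (finitarization E \<I>) X \<subseteq> mcl E \<I> X"
  unfolding mcl_def spans_def circuits_finitarization by blast

lemma finitary_closure_finitarization: "finitary_closure (mcl E (finitarization E \<I>))"
proof -
  interpret F: matroid E "finitarization E \<I>" by (rule matroid_finitarization)
  interpret exchange_closure "mcl E (finitarization E \<I>)" by (rule F.exchange_closure_mcl)
  show ?thesis
  proof
    fix x X assume "x \<in> mcl E (finitarization E \<I>) X"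
    then consider "x \<in> X" | C where "C \<in> circuits E (finitarization E \<I>)" "x \<in> C" "C - {x} \<subseteq> X"
      unfolding mcl_def spans_def by blast
    then show "\<exists>Y. finite Y \<and> Y \<subseteq> X \<and> x \<in> mcl E (finitarization E \<I>) Y"
    proof cases
      case 1
      then show ?thesis using ext[of "{x}"] by (intro exI[of _ "{x}"]) auto
    next
      case 2
      then have "finite (C - {x})" using circuits_finitarization by auto
      then show ?thesis using 2 by (intro exI[of _ "C - {x}"]) (auto simp: mcl_def spans_def)
    qed
  qed
qed

end

text \<open>By \<open>mcl_dual_iff\<close>, spanning a side turns into independence of the
  complement over the other side, and conversely. The sides swap roles, with
  \<open>E\<^sub>N - D\<close> and \<open>E\<^sub>M - A\<close> as the new spanning sets.\<close>

lemma split_solution_dual: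
  assumes M: "matroid E \<M>" and N: "matroid E \<N>" and s: "split_solution E (mcl E \<M>) (mcl E \<N>)"
  shows "split_solution E (mcl E (dual E \<M>)) (mcl E (dual E \<N>))"
proof -
  have spanning: "Y \<subseteq> mcl E (dual E \<I>) (Y - X)"
    if "matroid E \<I>" "cindep (contr (mcl E \<I>) (E - Y)) X" "X \<subseteq> Y" "Y \<subseteq> E" for \<I> X Y
  proof
    fix e assume e: "e \<in> Y"
    show "e \<in> mcl E (dual E \<I>) (Y - X)"
    proof (cases "e \<in> X")
      case True
      have "E - (Y - X) - {e} = X - {e} \<union> (E - Y)" using that True by blast
      then have "e \<notin> mcl E \<I> (E - (Y - X) - {e})"
        using that(2) True unfolding cindep_def contr_def by simp
      then show ?thesis using matroid.mcl_dual_iff[OF that(1), of "Y - X" e] True e that(4) by blast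
    next
      case False
      then show ?thesis using e mcl_ext[of "Y - X" E "dual E \<I>"] by blast
    qed
  qed
  have indep: "cindep (contr (mcl E (dual E \<I>)) (E - Y)) (Y - X)"
    if "matroid E \<I>" "Y \<subseteq> mcl E \<I> X" "X \<subseteq> Y" "Y \<subseteq> E" for \<I> X Y
    unfolding cindep_def contr_def
  proof
    fix e assume e: "e \<in> Y - X"
    let ?X = "Y - X - {e} \<union> (E - Y)"
    have "E - ?X - {e} = X" using e that by blast
    then show "e \<notin> mcl E (dual E \<I>) ?X"
      using matroid.mcl_dual_iff[OF that(1), of ?X e] e that by auto
  qed
  from s obtain E\<^sub>M E\<^sub>N A D where *: "E = E\<^sub>M \<union> E\<^sub>N" "E\<^sub>M \<inter> E\<^sub>N = {}"
    "A \<subseteq> E\<^sub>M" "E\<^sub>M \<subseteq> mcl E \<M> A" "cindep (contr (mcl E \<N>) E\<^sub>N) A"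
    "D \<subseteq> E\<^sub>N" "E\<^sub>N \<subseteq> mcl E \<N> D" "cindep (contr (mcl E \<M>) E\<^sub>M) D"
    unfolding split_solution_def by blast
  have eq: "E - E\<^sub>M = E\<^sub>N" "E - E\<^sub>N = E\<^sub>M" and sub: "E\<^sub>M \<subseteq> E" "E\<^sub>N \<subseteq> E" using * by auto
  show ?thesis
  proof (rule split_solutionI[of E E\<^sub>N E\<^sub>M "E\<^sub>N - D" _ _ "E\<^sub>M - A"])
    show "E\<^sub>N \<subseteq> mcl E (dual E \<M>) (E\<^sub>N - D)" using spanning[OF M _ *(6) sub(2)] *(8) eq by simp
    show "E\<^sub>M \<subseteq> mcl E (dual E \<N>) (E\<^sub>M - A)" using spanning[OF N _ *(3) sub(1)] *(5) eq by simp
    show "cindep (contr (mcl E (dual E \<N>)) E\<^sub>M) (E\<^sub>N - D)" using indep[OF N *(7,6) sub(2)] eq by simp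
    show "cindep (contr (mcl E (dual E \<M>)) E\<^sub>N) (E\<^sub>M - A)" using indep[OF M *(4,3) sub(1)] eq by simp
  qed (use * in auto)
qed

text \<open>\<open>A\<close> may be dependent in \<open>M\<close> and \<open>D\<close> in
  \<open>N\<close>. Bases \<open>A'\<close> and \<open>D'\<close> of them still span the sides, and
  independence over the other side lets them be united.\<close>

lemma (in closure_pair) split_solution_common_indep:
  assumes "split_solution E M N"
  obtains I E\<^sub>M E\<^sub>N where "I \<subseteq> E" "cindep M I" "cindep N I" "E = E\<^sub>M \<union> E\<^sub>N" "E\<^sub>M \<inter> E\<^sub>N = {}"
    "E\<^sub>M \<subseteq> M (I \<inter> E\<^sub>M)" "E\<^sub>N \<subseteq> N (I \<inter> E\<^sub>N)"
proof -
  from assms obtain E\<^sub>M E\<^sub>N A D where *: "E = E\<^sub>M \<union> E\<^sub>N" "E\<^sub>M \<inter> E\<^sub>N = {}"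
    "A \<subseteq> E\<^sub>M" "E\<^sub>M \<subseteq> M A" "cindep (contr N E\<^sub>N) A"
    "D \<subseteq> E\<^sub>N" "E\<^sub>N \<subseteq> N D" "cindep (contr M E\<^sub>M) D"
    unfolding split_solution_def by blast
  obtain A' where A': "A' \<subseteq> A" "cindep M A'" "A \<subseteq> M A'" using M.base[of "{}" A] by auto
  obtain D' where D': "D' \<subseteq> D" "cindep N D'" "D \<subseteq> N D'" using N.base[of "{}" D] by auto
  have spA: "E\<^sub>M \<subseteq> M A'" using * M.cl_least[OF A'(3)] by blast
  have spD: "E\<^sub>N \<subseteq> N D'" using * N.cl_least[OF D'(3)] by blast
  have "cindep (contr M E\<^sub>M) D'"
    by (rule M.cindep_contr_subset[OF *(8) D'(1)])
  moreover have "A' \<subseteq> M E\<^sub>M" using * A' M.ext[of E\<^sub>M] by blast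
  ultimately have 1: "cindep M (A' \<union> D')" using A' by (intro M.cindep_Un) auto
  have "cindep (contr N E\<^sub>N) A'"
    by (rule N.cindep_contr_subset[OF *(5) A'(1)])
  moreover have "D' \<subseteq> N E\<^sub>N" using * D' N.ext[of E\<^sub>N] by blast
  ultimately have "cindep N (D' \<union> A')" using D' by (intro N.cindep_Un) auto
  then have 2: "cindep N (A' \<union> D')" by (simp add: Un_commute)
  have 3: "(A' \<union> D') \<inter> E\<^sub>M = A'" "(A' \<union> D') \<inter> E\<^sub>N = D'" "A' \<union> D' \<subseteq> E" using * A' D' by blast+
  show thesis by (rule that[OF 3(3) 1 2 *(1,2)]) (use 3 spA spD in auto)
qed

lemma intersection_propertyI:
  assumes M: "matroid E \<M>" and N: "matroid E \<N>" and s: "split_solution E (mcl E \<M>) (mcl E \<N>)"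
  shows "intersection_property E \<M> \<N>"
proof -
  interpret closure_pair "mcl E \<M>" "mcl E \<N>"
    by (intro closure_pair.intro matroid.closure_matroid_mcl M N)
  obtain I E\<^sub>M E\<^sub>N where *: "I \<subseteq> E" "cindep (mcl E \<M>) I" "cindep (mcl E \<N>) I"
    "E = E\<^sub>M \<union> E\<^sub>N" "E\<^sub>M \<inter> E\<^sub>N = {}" "E\<^sub>M \<subseteq> mcl E \<M> (I \<inter> E\<^sub>M)" "E\<^sub>N \<subseteq> mcl E \<N> (I \<inter> E\<^sub>N)"
    by (rule split_solution_common_indep[OF s])
  have "I \<in> \<M> \<inter> \<N>"
    using * matroid.cindep_mcl[OF M, of I] matroid.cindep_mcl[OF N, of I] by blast
  moreover have "spans_set E \<M> (I \<inter> E\<^sub>M) E\<^sub>M" "spans_set E \<N> (I \<inter> E\<^sub>N) E\<^sub>N"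
    using * unfolding spans_set_def mcl_def by blast+
  ultimately show ?thesis using *(4,5) unfolding intersection_property_def by blast
qed

section \<open>Nearly finitary and nearly cofinitary matroids\<close>

text \<open>One-sided: these are the finite losses in passing from \<open>M'\<close> to
  \<open>M\<close> that \<open>finite_defect_split_solution\<close> can repair.\<close>

definition finitely_close :: "'a set \<Rightarrow> ('a set \<Rightarrow> 'a set) \<Rightarrow> ('a set \<Rightarrow> 'a set) \<Rightarrow> bool" where
  "finitely_close E M' M \<longleftrightarrow>
    (\<forall>I\<subseteq>E. cindep M' I \<longrightarrow> (\<exists>G. finite G \<and> cindep M (I - G))) \<and>
    (\<forall>X Y. X \<subseteq> Y \<longrightarrow> Y \<subseteq> E \<longrightarrow> Y \<subseteq> M' X \<longrightarrow> (\<exists>A. finite A \<and> Y \<subseteq> M (X \<union> A)))"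

lemma finitely_close_split_solution:
  assumes "closure_pair M' N'" "closure_pair M N"
    and "finitely_close E M' M" "finitely_close E N' N" and s: "split_solution E M' N'"
  shows "split_solution E M N"
proof -
  interpret P': closure_pair M' N' by fact
  interpret P: closure_pair M N by fact
  obtain I E\<^sub>M E\<^sub>N where *: "I \<subseteq> E" "cindep M' I" "cindep N' I"
    "E = E\<^sub>M \<union> E\<^sub>N" "E\<^sub>M \<inter> E\<^sub>N = {}" "E\<^sub>M \<subseteq> M' (I \<inter> E\<^sub>M)" "E\<^sub>N \<subseteq> N' (I \<inter> E\<^sub>N)"
    by (rule P'.split_solution_common_indep[OF s])
  obtain G H where G: "finite G" "cindep M (I - G)" and H: "finite H" "cindep N (I - H)"
    using assms(3,4) * unfolding finitely_close_def by meson
  have "E\<^sub>M \<subseteq> E" "E\<^sub>N \<subseteq> E" "I \<inter> E\<^sub>M \<subseteq> E\<^sub>M" "I \<inter> E\<^sub>N \<subseteq> E\<^sub>N" using * by auto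
  then obtain A D where A: "finite A" "E\<^sub>M \<subseteq> M (I \<inter> E\<^sub>M \<union> A)" and D: "finite D" "E\<^sub>N \<subseteq> N (I \<inter> E\<^sub>N \<union> D)"
    using assms(3,4) *(6,7) unfolding finitely_close_def by meson
  let ?I = "I - (G \<union> H)"
  show ?thesis
  proof (rule P.finite_defect_split_solution[OF _ _ _ *(4,5)])
    show "?I \<subseteq> E" using * by blast
    show "cindep M ?I" by (rule P.M.cindep_subset[OF G(2)]) blast
    show "cindep N ?I" by (rule P.N.cindep_subset[OF H(2)]) blast
    show "finite (A \<union> G \<union> H)" "finite (D \<union> G \<union> H)" using A D G H by auto
    have "M (I \<inter> E\<^sub>M \<union> A) \<subseteq> M (?I \<inter> E\<^sub>M \<union> (A \<union> G \<union> H))" by (rule P.M.mono) blast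
    then show "E\<^sub>M \<subseteq> M (?I \<inter> E\<^sub>M \<union> (A \<union> G \<union> H))" using A by blast
    have "N (I \<inter> E\<^sub>N \<union> D) \<subseteq> N (?I \<inter> E\<^sub>N \<union> (D \<union> G \<union> H))" by (rule P.N.mono) blast
    then show "E\<^sub>N \<subseteq> N (?I \<inter> E\<^sub>N \<union> (D \<union> G \<union> H))" using D by blast
  qed
qed

context matroid
begin

text \<open>Stated over an arbitrary \<open>Z\<close> because its dual form is the spanning half of
  closeness for nearly cofinitary matroids. The bases are nested as
  \<open>K \<subseteq> J \<subseteq> B \<subseteq> B\<^sub>F\<close>, and what \<open>X\<close>
  loses lies in \<open>B\<^sub>F - B\<close>.\<close>

lemma nearly_finitary_cindep_contr:
  assumes nf: "nearly_finitary E \<I>" and Z: "Z \<subseteq> E" and X: "X \<subseteq> E"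
    and ind: "cindep (contr (mcl E (finitarization E \<I>)) Z) X"
  shows "\<exists>G. finite G \<and> cindep (contr (mcl E \<I>) Z) (X - G)"
proof -
  interpret FM: matroid E "finitarization E \<I>" by (rule matroid_finitarization)
  define F where "F = mcl E (finitarization E \<I>)"
  define M where "M = mcl E \<I>"
  interpret M: closure_matroid M unfolding M_def by (rule closure_matroid_mcl)
  interpret F: closure_matroid F unfolding F_def by (rule FM.closure_matroid_mcl)
  have FM: "F Y \<subseteq> M Y" for Y unfolding F_def M_def by (rule mcl_finitarization_subset)
  have indFM: "cindep F Y" if "cindep M Y" for Y using that FM unfolding cindep_def by blast
  obtain K where K: "K \<subseteq> Z" "cindep M K" "Z \<subseteq> M K" using M.base[of "{}" Z] by auto
  obtain H where H: "K \<subseteq> H" "H \<subseteq> Z" "cindep F H" "Z \<subseteq> F H" using F.base[OF indFM[OF K(2)] K(1)] by blast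
  have "H \<subseteq> F Z" using H F.ext[of Z] by blast
  then have "cindep F (H \<union> X)" using F.cindep_Un[OF H(3)] ind unfolding F_def by blast
  moreover have "H \<union> X \<subseteq> E" using H X Z by blast
  ultimately obtain B\<^sub>F where BF: "H \<union> X \<subseteq> B\<^sub>F" "B\<^sub>F \<subseteq> E" "cindep F B\<^sub>F" "E \<subseteq> F B\<^sub>F" using F.base by metis
  obtain J where J: "K \<subseteq> J" "J \<subseteq> K \<union> X" "cindep M J" "K \<union> X \<subseteq> M J" using M.base[OF K(2), of "K \<union> X"] by blast
  have JB: "J \<subseteq> B\<^sub>F" using J H BF by blast
  obtain B where B: "J \<subseteq> B" "B \<subseteq> B\<^sub>F" "cindep M B" "B\<^sub>F \<subseteq> M B" using M.base[OF J(3) JB] by blast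
  have "F B\<^sub>F \<subseteq> M B" using FM[of B\<^sub>F] M.cl_least[OF B(4)] by blast
  then have "B \<in> bases \<I>"
    using BF B bases_mcl_iff cindep_mcl[of B] unfolding M_def by blast
  then obtain B' where B': "B' \<in> bases (finitarization E \<I>)" "B \<subseteq> B'" "finite (B' - B)"
    using nf unfolding nearly_finitary_def by blast
  have "E \<subseteq> F B'" using B' FM.bases_mcl_iff unfolding F_def by blast
  moreover have "B' - B \<union> B = B'" using B' by blast
  ultimately have "B\<^sub>F - B \<subseteq> contr F B (B' - B)" using BF unfolding contr_def by auto
  moreover have "B\<^sub>F - B \<union> B = B\<^sub>F" using B by blast
  then have "cindep (contr F B) (B\<^sub>F - B)" using F.cindep_split[of "B\<^sub>F - B" B] BF by auto
  \<comment> \<open>\<open>B'\<close> spans in the finitarization and exceeds \<open>B\<close> by a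
    finite set, which bounds every set independent over \<open>B\<close>.\<close>
  ultimately have fin: "finite (B\<^sub>F - B)" using steinitz[OF B'(3) F.exchange_closure_contr] by blast
  have "X - J \<subseteq> B\<^sub>F - B"
  proof
    fix x assume x: "x \<in> X - J"
    have "x \<notin> B"
    proof
      assume "x \<in> B"
      moreover have "M J \<subseteq> M (B - {x})" using B x by (intro M.mono) blast
      ultimately show False using B(3) J x unfolding cindep_def by blast
    qed
    then show "x \<in> B\<^sub>F - B" using x BF by blast
  qed
  then have "finite (X - J)" using fin finite_subset by blast
  have "X \<inter> F Z = {}" using F.cindep_contr_disjoint ind unfolding F_def by blast
  then have "X \<inter> Z = {}" using F.ext[of Z] by blast
  then have JZ: "J \<inter> Z = K" "J - Z = X - (X - J)" using J K by auto
  then have "cindep (contr M Z) (X - (X - J))" using M.cindep_contr_diff[OF J(3), of Z] K by simp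
  then show ?thesis using \<open>finite (X - J)\<close> unfolding M_def by blast
qed

lemma nearly_finitary_finitely_close:
  assumes "nearly_finitary E \<I>"
  shows "finitely_close E (mcl E (finitarization E \<I>)) (mcl E \<I>)"
  unfolding finitely_close_def
proof (intro conjI allI impI)
  fix I assume "I \<subseteq> E" "cindep (mcl E (finitarization E \<I>)) I"
  then show "\<exists>G. finite G \<and> cindep (mcl E \<I>) (I - G)"
    using nearly_finitary_cindep_contr[OF assms, of "{}" I] by simp
next
  fix X Y assume "Y \<subseteq> mcl E (finitarization E \<I>) X"
  then have "Y \<subseteq> mcl E \<I> (X \<union> {})" using mcl_finitarization_subset[of X] by simp
  then show "\<exists>A. finite A \<and> Y \<subseteq> mcl E \<I> (X \<union> A)" by blast
qed

text \<open>Here independence passes over without loss, while spanning may cost finitely many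
  elements; they come from \<open>nearly_finitary_cindep_contr\<close> in the dual, translated by
  \<open>mcl_dual_iff\<close>.\<close>

lemma nearly_cofinitary_finitely_close:
  assumes nc: "nearly_cofinitary E \<I>"
  shows "finitely_close E (mcl E (dual E (finitarization E (dual E \<I>)))) (mcl E \<I>)"
proof -
  interpret D: matroid E "dual E \<I>" by (rule matroid_dual)
  define \<K> where "\<K> = finitarization E (dual E \<I>)"
  interpret K: matroid E \<K> unfolding \<K>_def by (rule D.matroid_finitarization)
  interpret KD: matroid E "dual E \<K>" by (rule K.matroid_dual)
  have nf: "nearly_finitary E (dual E \<I>)" using nc unfolding nearly_cofinitary_def .
  have sub: "mcl E \<K> X \<subseteq> mcl E (dual E \<I>) X" for X
    unfolding \<K>_def by (rule D.mcl_finitarization_subset)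
  have "finitely_close E (mcl E (dual E \<K>)) (mcl E \<I>)"
    unfolding finitely_close_def
  proof (intro conjI allI impI)
    fix I assume I: "I \<subseteq> E" "cindep (mcl E (dual E \<K>)) I"
    then have "E \<subseteq> mcl E \<K> (E - I)" using KD.cindep_mcl K.dual_iff_spanning by blast
    then have sp: "E \<subseteq> mcl E (dual E \<I>) (E - I)" using sub by blast
    have "cindep (mcl E \<I>) I"
      unfolding cindep_def
    proof
      fix x assume x: "x \<in> I"
      have "E - (E - I) - {x} = I - {x}" using I by blast
      then show "x \<notin> mcl E \<I> (I - {x})" using mcl_dual_iff[of "E - I" x] sp x I by auto
    qed
    then show "\<exists>G. finite G \<and> cindep (mcl E \<I>) (I - G)" by (intro exI[of _ "{}"]) simp
  next
    fix X Y assume XY: "X \<subseteq> Y" "Y \<subseteq> E" "Y \<subseteq> mcl E (dual E \<K>) X"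
    have "cindep (contr (mcl E \<K>) (E - Y)) (Y - X)"
      unfolding cindep_def contr_def
    proof
      fix e assume e: "e \<in> Y - X"
      have "E - X - {e} = Y - X - {e} \<union> (E - Y)" using XY e by blast
      then show "e \<notin> mcl E \<K> (Y - X - {e} \<union> (E - Y))" using K.mcl_dual_iff[of X e] XY e by auto
    qed
    then obtain G where G: "finite G" "cindep (contr (mcl E (dual E \<I>)) (E - Y)) (Y - X - G)"
      using D.nearly_finitary_cindep_contr[OF nf, of "E - Y" "Y - X"] XY unfolding \<K>_def by blast
    have "e \<in> mcl E \<I> (X \<union> G \<inter> Y)" if e: "e \<in> Y" for e
    proof (cases "e \<in> X \<union> G \<inter> Y")
      case True
      then show ?thesis using mcl_ext[of "X \<union> G \<inter> Y" E \<I>] by blast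
    next
      case False
      let ?X = "Y - X - G - {e} \<union> (E - Y)"
      have eq: "E - ?X - {e} = X \<union> G \<inter> Y" using XY e False by blast
      have "e \<in> Y - X - G" using e False by blast
      then have "e \<notin> mcl E (dual E \<I>) ?X" using G(2) unfolding cindep_def contr_def by blast
      then show ?thesis using mcl_dual_iff[of ?X e] XY e unfolding eq by auto
    qed
    then show "\<exists>A. finite A \<and> Y \<subseteq> mcl E \<I> (X \<union> A)" using G(1) by (intro exI[of _ "G \<inter> Y"]) auto
  qed
  then show ?thesis unfolding \<K>_def .
qed

end

section \<open>Waves\<close>

locale finitary_pair = M: finitary_closure M + N: finitary_closure N
  for M N :: "'a set \<Rightarrow> 'a set"

sublocale finitary_pair \<subseteq> closure_pair ..

text \<open>A wave is determined by its base \<open>B\<close>, since one may always pass to the set \<open>E \<inter> M B\<close>.\<close>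

definition wave where
  "wave E M N B \<longleftrightarrow> B \<subseteq> E \<and> cindep M B \<and> cindep (contr N (E - M B)) B"

text \<open>Asks for a span that contains every wave, not just for a base maximal under inclusion;
  \<open>wave_sum\<close> bridges the gap.\<close>

definition maximal_wave where
  "maximal_wave E M N B \<longleftrightarrow> wave E M N B \<and> (\<forall>B'. wave E M N B' \<longrightarrow> B' \<subseteq> M B)"

text \<open>A violating wave is a hindrance: even together with everything outside its span,
  \<open>B\<close> fails to span that span in \<open>N\<close>.\<close>

definition unhindered where
  "unhindered E M N \<longleftrightarrow> (\<forall>B. wave E M N B \<longrightarrow> E \<inter> M B \<subseteq> N (B \<union> (E - M B)))"

text \<open>The second clause says that the empty wave, whose span consists of the loops of
  \<open>M\<close>, is no hindrance. Contracted elements become loops, so it has content in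
  \<open>feasible\<close>.\<close>

definition wave_free where
  "wave_free E M N \<longleftrightarrow> (\<forall>B. wave E M N B \<longrightarrow> B = {}) \<and> E \<inter> M {} \<subseteq> N (E - M {})"

definition feasible where
  "feasible E M N I \<longleftrightarrow> I \<subseteq> E \<and> cindep M I \<and> cindep N I \<and> wave_free E (contr M I) (contr N I)"

context finitary_pair
begin

lemma finitary_pair_contr: "finitary_pair (contr M Y) (contr N Z)"
  by (intro finitary_pair.intro M.finitary_closure_contr N.finitary_closure_contr)

lemma waveI:
  assumes "B \<subseteq> W" "W \<subseteq> E" "W \<subseteq> M B" "cindep M B" "cindep (contr N (E - W)) B"
  shows "wave E M N B"
proof -
  have "E - M B \<subseteq> N (E - W)" using assms(3) N.ext[of "E - W"] by blast
  then show ?thesis using assms N.cindep_contr_mono[OF assms(5)] unfolding wave_def by blast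
qed

lemma wave_empty: "wave E M N {}"
  unfolding wave_def by simp

text \<open>\<open>J - B\<close> is part of \<open>C\<close>, hence independent in \<open>N\<close>
  over \<open>E - M C\<close> and so over \<open>E - M J\<close>. It lies in \<open>E - M B\<close>,
  over which \<open>B\<close> is independent, so the two parts fit together.\<close>

lemma wave_sum:
  assumes B: "wave E M N B" and C: "wave E M N C"
  obtains J where "B \<subseteq> J" "wave E M N J" "C \<subseteq> M J"
proof -
  obtain J where J: "B \<subseteq> J" "J \<subseteq> B \<union> C" "cindep M J" "B \<union> C \<subseteq> M J"
    using M.base[of B "B \<union> C"] B unfolding wave_def by auto
  interpret P: finitary_pair "contr M {}" "contr N (E - M J)" by (rule finitary_pair_contr)
  have MB: "M B \<subseteq> M J" using J by (intro M.mono) blast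
  have MC: "M C \<subseteq> M J" by (rule M.cl_least) (use J(4) in blast)
  have disj: "(J - B) \<inter> M B = {}"
    using M.cindep_contr_disjoint[OF M.cindep_split[of "J - B" B]] J by (auto simp: Un_absorb2)
  have "cindep (contr N (E - M C)) (J - B)"
    by (rule N.cindep_contr_subset[of _ C]) (use C J(2) in \<open>auto simp: wave_def\<close>)
  moreover have "E - M J \<subseteq> N (E - M C)" using MC N.ext[of "E - M C"] by blast
  ultimately have 1: "cindep (contr N (E - M J)) (J - B)" by (rule N.cindep_contr_mono)
  have "E - M J \<union> (E - M B) = E - M B" using MB by blast
  then have 2: "cindep (contr (contr N (E - M J)) (E - M B)) B" using B unfolding wave_def by simp
  have "J \<subseteq> E" using B C J unfolding wave_def by blast
  then have "J - B \<subseteq> contr N (E - M J) (E - M B)"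
    using disj P.N.ext[of "E - M B"] by blast
  from P.N.cindep_Un[OF 1 this 2] have "cindep (contr N (E - M J)) J"
    using J by (simp add: Un_absorb2)
  then show thesis using that[of J] J \<open>J \<subseteq> E\<close> unfolding wave_def by blast
qed

lemma maximal_wave_exists: "\<exists>B. maximal_wave E M N B"
proof -
  let ?S = "{B. wave E M N B}"
  have "\<exists>B\<in>?S. \<forall>Y\<in>?S. B \<subseteq> Y \<longrightarrow> Y = B"
  proof (rule subset_Zorn_nonempty)
    show "?S \<noteq> {}" using wave_empty by blast
  next
    fix \<C> assume ch: "subset.chain ?S \<C>"
    interpret P: finitary_pair "contr M {}" "contr N (E - M (\<Union>\<C>))" by (rule finitary_pair_contr)
    have sub: "\<And>B. B \<in> \<C> \<Longrightarrow> wave E M N B" and lin: "\<And>A B. A \<in> \<C> \<Longrightarrow> B \<in> \<C> \<Longrightarrow> A \<subseteq> B \<or> B \<subseteq> A"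
      using ch unfolding subset.chain_def by blast+
    have each: "cindep (contr N (E - M (\<Union>\<C>))) B" if B: "B \<in> \<C>" for B
    proof -
      have "M B \<subseteq> M (\<Union>\<C>)" using B by (intro M.mono) blast
      then have "E - M (\<Union>\<C>) \<subseteq> N (E - M B)" using N.ext[of "E - M B"] by blast
      with sub[OF B] show ?thesis unfolding wave_def using N.cindep_contr_mono[of "E - M B"] by simp
    qed
    have "cindep M (\<Union>\<C>)"
      by (rule M.cindep_Union_chain[OF lin]) (use sub in \<open>auto simp: wave_def\<close>)
    moreover have "cindep (contr N (E - M (\<Union>\<C>))) (\<Union>\<C>)"
      by (rule P.N.cindep_Union_chain[OF lin each])
    moreover have "\<Union>\<C> \<subseteq> E" using sub unfolding wave_def by blast
    ultimately show "\<Union>\<C> \<in> ?S" unfolding wave_def by blast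
  qed
  then obtain B where B: "wave E M N B" and max: "\<And>Y. wave E M N Y \<Longrightarrow> B \<subseteq> Y \<Longrightarrow> Y = B" by blast
  have "C \<subseteq> M B" if C: "wave E M N C" for C
  proof -
    obtain J where "B \<subseteq> J" "wave E M N J" "C \<subseteq> M J" by (rule wave_sum[OF B C])
    then show ?thesis using max by metis
  qed
  then show ?thesis using B unfolding maximal_wave_def by blast
qed

lemma wave_extend:
  assumes B: "wave E M N B" and C: "C \<subseteq> E" "cindep (contr M B) C"
    "cindep (contr N (B \<union> (E - M (B \<union> C)))) C"
  shows "wave E M N (B \<union> C)"
proof -
  interpret P: finitary_pair "contr M {}" "contr N (E - M (B \<union> C))" by (rule finitary_pair_contr)
  have M: "cindep M (B \<union> C)" using M.cindep_Un[OF _ M.ext C(2)] B unfolding wave_def by blast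
  have "M B \<subseteq> M (B \<union> C)" by (rule M.mono) blast
  then have "E - M (B \<union> C) \<subseteq> N (E - M B)" using N.ext[of "E - M B"] by blast
  then have "cindep (contr N (E - M (B \<union> C))) B"
    using B unfolding wave_def using N.cindep_contr_mono[of "E - M B"] by simp
  moreover have "cindep (contr (contr N (E - M (B \<union> C))) B) C" using C(3) by (simp add: Un_commute)
  ultimately have "cindep (contr N (E - M (B \<union> C))) (B \<union> C)"
    by (rule P.N.cindep_Un[OF _ P.N.ext])
  then show ?thesis using M B C unfolding wave_def by blast
qed

text \<open>A nonempty wave of the contracted pair would extend \<open>B\<close> beyond its span.
  That the new loops are no hindrance is unhinderedness applied to \<open>B\<close>.\<close>

lemma wave_free_contr_wave:
  assumes B: "maximal_wave E M N B" and u: "unhindered E M N"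
  shows "wave_free E (contr M B) (contr N B)"
  unfolding wave_free_def
proof (intro conjI allI impI)
  have w: "wave E M N B" using B unfolding maximal_wave_def by blast
  show "E \<inter> contr M B {} \<subseteq> contr N B (E - contr M B {})"
    using u w unfolding unhindered_def contr_def by (simp add: Un_commute)
  fix C assume C: "wave E (contr M B) (contr N B) C"
  then have "cindep (contr M B) C" "C \<subseteq> E" "cindep (contr N (B \<union> (E - M (B \<union> C)))) C"
    unfolding wave_def by (simp_all, simp add: contr_def Un_commute)
  then have "wave E M N (B \<union> C)" using wave_extend[OF w] by blast
  then have "C \<subseteq> M B" using B unfolding maximal_wave_def by blast
  moreover have "C \<inter> M B = {}" by (rule M.cindep_contr_disjoint) (use C in \<open>simp add: wave_def\<close>)
  ultimately show "C = {}" by blast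
qed

lemma wave_free_contr_right:
  assumes "wave_free E M N"
  shows "wave_free E M (contr N Z)"
  unfolding wave_free_def
proof (intro conjI allI impI)
  have "N (E - M {}) \<subseteq> contr N Z (E - M {})" unfolding contr_def by (rule N.mono) blast
  then show "E \<inter> M {} \<subseteq> contr N Z (E - M {})" using assms unfolding wave_free_def by blast
  fix B assume B: "wave E M (contr N Z) B"
  then have "cindep (contr N (Z \<union> (E - M B))) B" unfolding wave_def by simp
  moreover have "E - M B \<subseteq> N (Z \<union> (E - M B))" using N.ext[of "Z \<union> (E - M B)"] by blast
  ultimately have "cindep (contr N (E - M B)) B" by (rule N.cindep_contr_mono)
  then show "B = {}" using B assms unfolding wave_free_def wave_def by blast
qed

text \<open>
  A hindrance after contracting \<open>g\<close> in \<open>M\<close> is a deficiency of one, which an augmenting path inside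
  the wave would repair to a wave of the original pair; if there is no such path, then the region
  reached is already a hindrance of the original pair.
\<close>

lemma unhindered_contr_left:
  assumes free: "wave_free E M N" and g: "g \<in> E"
  shows "unhindered E (contr M {g}) N"
  unfolding unhindered_def
proof (intro allI impI subsetI)
  fix B x assume B: "wave E (contr M {g}) N B" and x: "x \<in> E \<inter> contr M {g} B"
  define W where "W = E \<inter> M (insert g B)"
  have cg: "contr M {g} B = M (insert g B)" unfolding contr_def by simp
  have EW: "E - W = E - contr M {g} B" unfolding W_def cg by blast
  have xW: "x \<in> W" using x unfolding W_def cg .
  have BW: "B \<subseteq> W" "W \<subseteq> E" "g \<in> W"
    using B g M.ext[of "insert g B"] unfolding W_def wave_def by auto
  have "cindep (contr M {g}) B" using B unfolding wave_def by blast
  then have BM: "cindep M B" using M.cindep_contr_mono[of "{g}" B "{}"] by simp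
  interpret P: finitary_pair "contr M {}" "contr N (E - W)" by (rule finitary_pair_contr)
  have BN: "cindep (contr N (E - W)) B" using B unfolding wave_def EW by blast
  show "x \<in> N (B \<union> (E - contr M {g} B))"
  proof (rule ccontr)
    assume "x \<notin> N (B \<union> (E - contr M {g} B))"
    then have nx: "x \<notin> contr N (E - W) B" unfolding EW[symmetric] by (simp add: contr_def)
    define T where "T = W - contr N (E - W) B"
    have T: "T \<subseteq> W - B" "T \<inter> contr N (E - W) B = {}" unfolding T_def using P.N.ext[of B] by auto
    show False
    proof (cases "reach M (contr N (E - W)) W B T \<subseteq> M B")
      case False
      then obtain u y k where p: "augmenting_path M (contr N (E - W)) W B u y k"
        using augmenting_path_exists[of T W B "contr N (E - W)" _ M] T by blast
      let ?B = "flip B u y k"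
      have pM: "augmenting_path (contr M {}) (contr N (E - W)) W B u y k" using p by simp
      have uk: "u k \<in> W" "u k \<notin> M B" using p unfolding augmenting_path_def by auto
      \<comment> \<open>The path ends at an element that \<open>B\<close> spans only with the help
        of \<open>g\<close>; by exchange the flipped set spans \<open>g\<close>, and with it
        \<open>W\<close>, in the original \<open>M\<close>.\<close>
      then have "g \<in> M (insert (u k) B)" using M.exchange[of "u k" g B] unfolding W_def by blast
      then have "insert g B \<subseteq> M (insert (u k) B)" using M.ext[of "insert (u k) B"] by blast
      then have "M (insert g B) \<subseteq> M (insert (u k) B)" by (rule M.cl_least)
      then have "W \<subseteq> M ?B" using P.flip_M(2)[OF _ pM] BM unfolding W_def by auto
      moreover have "cindep M ?B" using P.flip_M(1)[OF _ pM] BM by simp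
      moreover have "cindep (contr N (E - W)) ?B" by (rule P.flip_N(1)[OF BN pM])
      moreover have "?B \<subseteq> W" by (rule P.flip_subset[OF BW(1) pM])
      ultimately have "wave E M N ?B" using BW(2) by (intro waveI)
      then have "?B = {}" using free unfolding wave_free_def by blast
      then show False unfolding flip_def by auto
    next
      case True
      define R where "R = region M (contr N (E - W)) W B T"
      have TR: "T \<subseteq> R" using T_subset_reach[of T M "contr N (E - W)" W B] unfolding R_def region_def by blast
      have RW: "R \<subseteq> W" unfolding R_def by (rule region_subset[OF T(1) BW(1)])
      have sp: "R \<subseteq> M (B \<inter> R)"
        using P.region_spanned[of B W T] BM True unfolding R_def by simp
      have "W - R \<subseteq> contr N (E - W) (B - R)"
      proof
        fix z assume z: "z \<in> W - R"
        then have "z \<in> contr N (E - W) B" using TR unfolding T_def by blast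
        then show "z \<in> contr N (E - W) (B - R)"
          using P.outside_region_spanned[OF BN T(1), of z] z unfolding R_def by simp
      qed
      moreover have "E - W \<subseteq> contr N (E - W) (B - R)"
        unfolding contr_def using N.ext[of "B - R \<union> (E - W)"] by blast
      ultimately have out: "E - R \<subseteq> N (E - W \<union> (B - R))"
        unfolding contr_def by (auto simp: Un_commute)
      have "cindep (contr (contr N (E - W)) (B - R)) (B \<inter> R)"
        by (rule P.N.cindep_split) (use BN in \<open>auto simp: Int_Diff_Un\<close>)
      then have "cindep (contr N (E - W \<union> (B - R))) (B \<inter> R)" by simp
      then have "cindep (contr N (E - R)) (B \<inter> R)" using out by (rule N.cindep_contr_mono)
      then have "wave E M N (B \<inter> R)"
        using sp RW BW M.cindep_subset[OF BM] by (intro waveI[of _ R]) auto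
      \<comment> \<open>The region is a wave with empty base and so consists of loops of
        \<open>M\<close>; wave-freeness has these, \<open>x\<close> among them, spanned in
        \<open>N\<close> by the nonloops.\<close>
      then have e: "B \<inter> R = {}" using free unfolding wave_free_def by blast
      then have R0: "R \<subseteq> M {}" using sp by simp
      have "x \<in> R" using TR xW nx unfolding T_def by blast
      then have "x \<in> N (E - M {})" using R0 RW BW free unfolding wave_free_def by blast
      moreover have "E - M {} \<subseteq> N (E - W \<union> (B - R))" using R0 out by blast
      then have "N (E - M {}) \<subseteq> N (E - W \<union> (B - R))" by (rule N.cl_least)
      moreover have "N (E - W \<union> (B - R)) \<subseteq> contr N (E - W) B" unfolding contr_def by (rule N.mono) blast
      ultimately show False using nx by blast
    qed
  qed
qed

end

section \<open>Spanning a given element\<close>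

text \<open>Disjointness from \<open>M (flip I x y k)\<close> keeps \<open>B\<close> out of the
  core, which the flipped set still spans in \<open>M\<close>. In \<open>step_exists\<close> the set
  \<open>B\<close> is the base of a maximal wave.\<close>

definition step where
  "step E M N I J \<longleftrightarrow> feasible E M N J \<and>
    (\<exists>x y k B. augmenting_path M N E I x y k \<and> J = flip I x y k \<union> B \<and> B \<inter> M (flip I x y k) = {})"

definition unspannable where
  "unspannable E M N I = {x \<in> E. \<forall>J. (step E M N)\<^sup>*\<^sup>* I J \<longrightarrow> x \<notin> N J}"

definition core where
  "core E M N I = region M N E I (unspannable E M N I)"

lemma finite_subset_incseq:
  fixes A :: "nat \<Rightarrow> 'a set"
  assumes "\<And>i j. i \<le> j \<Longrightarrow> A i \<subseteq> A j" "finite Y" "Y \<subseteq> (\<Union>n. A n)"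
  shows "\<exists>n. Y \<subseteq> A n"
  using assms(2,3)
proof (induction Y rule: finite_induct)
  case (insert y Y)
  then obtain m n where "Y \<subseteq> A m" "y \<in> A n" by blast
  moreover have "A m \<subseteq> A (max m n)" "A n \<subseteq> A (max m n)" by (rule assms(1); simp)+
  ultimately have "insert y Y \<subseteq> A (max m n)" by blast
  then show ?case by blast
qed simp

context finitary_pair
begin

text \<open>On closures the flip acts like adding \<open>x k\<close> in \<open>M\<close> and
  \<open>x 0\<close> in \<open>N\<close>. Contracting \<open>x 0\<close> in \<open>N\<close> keeps
  the pair wave-free, contracting \<open>x k\<close> in \<open>M\<close> leaves it unhindered, and
  contracting a maximal wave then makes it wave-free again.\<close>

lemma step_exists:
  assumes I: "feasible E M N I" and p: "augmenting_path M N E I x y k"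
  obtains J where "step E M N I J" "x 0 \<in> N J"
proof -
  let ?F = "flip I x y k"
  have Ii: "I \<subseteq> E" "cindep M I" "cindep N I" using I unfolding feasible_def by auto
  have F: "?F \<subseteq> E" "cindep M ?F" "cindep N ?F" "M ?F = M (insert (x k) I)" "N ?F = N (insert (x 0) I)"
    using flip_subset[OF Ii(1) p] flip_M[OF Ii(2) p] flip_N[OF Ii(3) p] by auto
  have cM: "contr M ?F = contr (contr M I) {x k}" using M.contr_cong[OF F(4)] by simp
  have cN: "contr N ?F = contr (contr N I) {x 0}" using N.contr_cong[OF F(5)] by simp
  interpret P: finitary_pair "contr M I" "contr N I" by (rule finitary_pair_contr)
  interpret Q: finitary_pair "contr M I" "contr N ?F" by (rule finitary_pair_contr)
  interpret R: finitary_pair "contr M ?F" "contr N ?F" by (rule finitary_pair_contr)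
  have "wave_free E (contr M I) (contr N ?F)"
    unfolding cN using I by (intro P.wave_free_contr_right) (simp add: feasible_def)
  moreover have "x k \<in> E" using p unfolding augmenting_path_def by auto
  ultimately have u: "unhindered E (contr M ?F) (contr N ?F)"
    unfolding cM by (rule Q.unhindered_contr_left)
  obtain B where B: "maximal_wave E (contr M ?F) (contr N ?F) B" using R.maximal_wave_exists by blast
  have w: "B \<subseteq> E" "cindep (contr M ?F) B" "cindep (contr (contr N ?F) (E - contr M ?F B)) B"
    using B unfolding maximal_wave_def wave_def by auto
  have "cindep (contr N ?F) B" using Q.N.cindep_contr_mono[OF w(3), of "{}"] by simp
  then have "cindep N (?F \<union> B)" by (rule N.cindep_Un[OF F(3) N.ext])
  moreover have "cindep M (?F \<union> B)" by (rule M.cindep_Un[OF F(2) M.ext w(2)])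
  moreover have "wave_free E (contr M (?F \<union> B)) (contr N (?F \<union> B))"
    using R.wave_free_contr_wave[OF B u] by simp
  ultimately have "feasible E M N (?F \<union> B)" using F w unfolding feasible_def by blast
  moreover have "B \<inter> M ?F = {}" by (rule M.cindep_contr_disjoint[OF w(2)])
  ultimately have "step E M N I (?F \<union> B)" using p unfolding step_def by blast
  moreover have "x 0 \<in> N (?F \<union> B)"
    using F(5) N.mono[of ?F "?F \<union> B"] N.ext[of "insert (x 0) I"] by blast
  ultimately show thesis using that by blast
qed

lemma feasible_steps: "(step E M N)\<^sup>*\<^sup>* I J \<Longrightarrow> feasible E M N I \<Longrightarrow> feasible E M N J"
  by (induction rule: rtranclp_induct) (auto simp: step_def)

lemma unspannable_subset: "unspannable E M N I \<subseteq> E - N I"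
  unfolding unspannable_def by blast

lemma unspannable_mono: "(step E M N)\<^sup>*\<^sup>* I J \<Longrightarrow> unspannable E M N I \<subseteq> unspannable E M N J"
  unfolding unspannable_def by (auto intro: rtranclp_trans)

lemma unspannable_outside: "unspannable E M N I \<subseteq> E - I"
  using unspannable_subset[of E I] N.ext[of I] by blast

text \<open>Otherwise an augmenting path would start at an unspannable element, and the resulting
  step would span it.\<close>

lemma reach_unspannable:
  assumes "feasible E M N I"
  shows "reach M N E I (unspannable E M N I) \<subseteq> M I"
proof
  fix z assume z: "z \<in> reach M N E I (unspannable E M N I)"
  show "z \<in> M I"
  proof (rule ccontr)
    assume "z \<notin> M I"
    moreover have "unspannable E M N I \<inter> N I = {}" using unspannable_subset[of E I] by blast
    ultimately obtain x y k where p: "augmenting_path M N E I x y k" "x 0 \<in> unspannable E M N I"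
      using augmenting_path_exists[of "unspannable E M N I" E I N z M] unspannable_outside z by blast
    obtain J where "step E M N I J" "x 0 \<in> N J" by (rule step_exists[OF assms p(1)])
    then show False using p(2) unfolding unspannable_def by blast
  qed
qed

lemma core_subset: "feasible E M N I \<Longrightarrow> core E M N I \<subseteq> E"
  unfolding core_def feasible_def by (intro region_subset unspannable_outside) blast

lemma unspannable_core: "unspannable E M N I \<subseteq> core E M N I"
  unfolding core_def region_def using T_subset_reach[of _ M N E I] by blast

lemma core_spanned: "feasible E M N I \<Longrightarrow> core E M N I \<subseteq> M (I \<inter> core E M N I)"
  unfolding core_def by (rule region_spanned[OF _ reach_unspannable]) (simp_all add: feasible_def)

lemma outside_core_spanned:
  assumes "feasible E M N I" "z \<in> E" "z \<in> N I" "z \<notin> core E M N I"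
  shows "z \<in> N (I - core E M N I)"
  using assms outside_region_spanned[OF _ unspannable_outside, of I z E] unfolding core_def feasible_def
  by blast

text \<open>Path and added wave avoid the core, so \<open>I\<close> is unchanged there. The arcs
  inside the core survive, hence everything reached before is reached again.\<close>

lemma step_mono:
  assumes I: "feasible E M N I" and s: "step E M N I J"
  shows "N I \<subseteq> N J" "core E M N I \<inter> J = core E M N I \<inter> I" "core E M N I \<subseteq> core E M N J"
proof -
  let ?T = "unspannable E M N I"
  define R where "R = core E M N I"
  have Ii: "I \<subseteq> E" "cindep M I" "cindep N I" using I unfolding feasible_def by auto
  from s obtain x y k B where p: "augmenting_path M N E I x y k" and J: "J = flip I x y k \<union> B"
    and B: "B \<inter> M (flip I x y k) = {}" and fJ: "feasible E M N J"
    unfolding step_def by blast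
  have Ji: "cindep M J" "cindep N J" using fJ unfolding feasible_def by auto
  have "N I \<subseteq> N (flip I x y k)" unfolding flip_N(2)[OF Ii(3) p] by (rule N.mono) blast
  also have "\<dots> \<subseteq> N J" unfolding J by (rule N.mono) blast
  finally show NIJ: "N I \<subseteq> N J" .
  have av: "x i \<notin> R" if "i \<le> k" for i
    using path_avoids_region(1)[OF p unspannable_outside reach_unspannable[OF I] that]
    unfolding R_def core_def .
  have avy: "y i \<notin> R" if "i < k" for i
    using path_avoids_region(2)[OF p unspannable_outside reach_unspannable[OF I] that]
    unfolding R_def core_def .
  have "M (I \<inter> R) \<subseteq> M (insert (x k) I)" by (rule M.mono) blast
  then have "R \<subseteq> M (flip I x y k)"
    using core_spanned[OF I] unfolding flip_M(2)[OF Ii(2) p] R_def by blast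
  then have BR: "B \<inter> R = {}" using B by blast
  have fR: "flip I x y k \<inter> R = I \<inter> R" unfolding flip_def using av avy by auto
  show JR: "core E M N I \<inter> J = core E M N I \<inter> I" using BR fR unfolding J R_def by blast
  \<comment> \<open>The exchanges of the path in \<open>N\<close> can be carried out within the
    complement of \<open>R\<close>, where \<open>I - R\<close> already spans each
    \<open>x (Suc i)\<close>.\<close>
  have IRJ: "N (I - R) \<subseteq> N (J - R)"
  proof -
    have inj: "y i \<in> I - R" "x (Suc i) \<in> E" "x (Suc i) \<notin> I" "x (Suc i) \<in> N I" "x (Suc i) \<notin> N (I - {y i})"
      if "i < k" for i
      using p avy[OF that] that unfolding augmenting_path_def by auto
    have sp: "x (Suc i) \<in> N (I - R)" if "i < k" for i
      using outside_core_spanned[OF I] inj[OF that] av[of "Suc i"] that unfolding R_def by simp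
    have "N (I - R - y ` {..<k} \<union> (\<lambda>i. x (Suc i)) ` {..<k}) = N (I - R)"
    proof (rule N.triangular_swap[THEN conjunct2])
      show "cindep N (I - R)" by (rule N.cindep_subset[OF Ii(3)]) blast
      fix i assume i: "i < k"
      have "N (I - R - {y i}) \<subseteq> N (I - {y i})" by (rule N.mono) blast
      then show "y i \<in> I - R \<and> x (Suc i) \<notin> I - R \<and> x (Suc i) \<in> N (I - R) \<and> x (Suc i) \<notin> N (I - R - {y i})"
        using inj[OF i] sp[OF i] by blast
    next
      fix i j assume ij: "i < j" "j < k"
      have "x (Suc j) \<in> N (I - {y i})" using p ij unfolding augmenting_path_def by blast
      then have "x (Suc j) \<in> N ((I - R) \<inter> (I - {y i}))"
        by (intro N.cl_Int[OF Ii(3)] sp ij) auto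
      moreover have "(I - R) \<inter> (I - {y i}) = I - R - {y i}" by blast
      ultimately show "x (Suc j) \<in> N (I - R - {y i})" by simp
    qed
    moreover have "I - R - y ` {..<k} \<union> (\<lambda>i. x (Suc i)) ` {..<k} \<subseteq> J - R"
      unfolding J flip_def using av by auto
    ultimately show ?thesis using N.mono by metis
  qed
  \<comment> \<open>The \<open>M\<close>-circuit of \<open>u\<close> lies in
    \<open>I \<inter> R\<close>, which is also part of \<open>J\<close>.\<close>
  have keepM: "u \<notin> M (J - {v})" if "u \<in> R" "v \<in> I" "u \<notin> M (I - {v})" for u v
  proof
    assume a: "u \<in> M (J - {v})"
    have "u \<in> M (I \<inter> R)" using core_spanned[OF I] that(1) unfolding R_def by blast
    moreover have "I \<inter> R \<subseteq> J" using JR unfolding R_def by blast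
    ultimately have "u \<in> M ((I \<inter> R) \<inter> (J - {v}))" using M.cl_Int[OF Ji(1) _ _ Diff_subset a] by blast
    moreover have "M ((I \<inter> R) \<inter> (J - {v})) \<subseteq> M (I - {v})" by (rule M.mono) blast
    ultimately show False using that(3) by blast
  qed
  \<comment> \<open>\<open>J - {v}\<close> spans \<open>I - {v}\<close>; if it spanned
    \<open>z\<close> too, it would span \<open>v\<close> by exchange.\<close>
  have keepN: "z \<notin> N (J - {v})" if v: "v \<in> I" "v \<in> R" and z: "z \<in> N I" "z \<notin> N (I - {v})" for z v
  proof
    assume a: "z \<in> N (J - {v})"
    have vJ: "v \<in> J" using v JR unfolding R_def by blast
    have "N (J - R) \<subseteq> N (J - {v})" using v by (intro N.mono) blast
    then have "I - R \<subseteq> N (J - {v})" using IRJ N.ext[of "I - R"] by blast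
    moreover have "I \<inter> R - {v} \<subseteq> N (J - {v})" using JR N.ext[of "J - {v}"] unfolding R_def by blast
    ultimately have "insert z (I - {v}) \<subseteq> N (J - {v})" using a by blast
    then have "N (insert z (I - {v})) \<subseteq> N (J - {v})" by (rule N.cl_least)
    then have "v \<in> N (J - {v})" using N.exchange_remove[OF v(1) z] by blast
    then show False using Ji(2) vJ unfolding cindep_def by blast
  qed
  have inR: "v \<in> R" if "u \<in> reach M N E I ?T" "v \<in> I" "u \<notin> M (I - {v})" for u v
    using that unfolding R_def core_def region_def by blast
  have reachR: "u \<in> R" if "u \<in> reach M N E I ?T" for u
    using that unfolding R_def core_def region_def by blast
  have reach: "z \<in> reach M N E J (unspannable E M N J)" if "z \<in> reach M N E I ?T" for z
    using that
  proof (induction rule: reach_induct)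
    case (start z)
    have "(step E M N)\<^sup>*\<^sup>* I J" using s by blast
    then have "z \<in> unspannable E M N J" using start unspannable_mono by blast
    then show ?case using T_subset_reach[of "unspannable E M N J" M N E J] by blast
  next
    case (step u v z)
    have "z \<in> reach M N E I ?T" by (rule reach_step[OF step(1,2,3,4,5,6)])
    then have zR: "z \<in> R" by (rule reachR)
    have vR: "v \<in> R" by (rule inR[OF step(1,2,3)])
    show ?case
    proof (rule reach_step[OF step(7)])
      show "v \<in> J" using vR step(2) JR unfolding R_def by blast
      show "u \<notin> M (J - {v})" by (rule keepM[OF reachR[OF step(1)] step(2,3)])
      show "z \<in> E - J" using zR step(4) JR unfolding R_def by blast
      show "z \<in> N J" using step(5) NIJ by blast
      show "z \<notin> N (J - {v})" by (rule keepN[OF step(2) vR step(5,6)])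
    qed
  qed
  show "core E M N I \<subseteq> core E M N J"
  proof
    fix z assume z: "z \<in> core E M N I"
    show "z \<in> core E M N J"
    proof (cases "z \<in> reach M N E I ?T")
      case True
      then show ?thesis using reach unfolding core_def region_def by blast
    next
      case False
      then obtain u where u: "u \<in> reach M N E I ?T" "u \<notin> M (I - {z})" "z \<in> I"
        using z unfolding core_def region_def by blast
      have "u \<notin> M (J - {z})" by (rule keepM[OF reachR[OF u(1)] u(3,2)])
      moreover have "z \<in> J" using u z JR by blast
      ultimately show ?thesis using reach[OF u(1)] unfolding core_def region_def by blast
    qed
  qed
qed

lemma steps_mono:
  assumes "(step E M N)\<^sup>*\<^sup>* I J" "feasible E M N I"
  shows "N I \<subseteq> N J \<and> core E M N I \<inter> J = core E M N I \<inter> I \<and> core E M N I \<subseteq> core E M N J"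
  using assms
proof (induction rule: rtranclp_induct)
  case base
  show ?case by (intro conjI order_refl refl)
next
  case (step J K)
  have "feasible E M N J" by (rule feasible_steps[OF step(1,4)])
  note * = step_mono[OF this step(2)]
  have IH: "N I \<subseteq> N J" "core E M N I \<inter> J = core E M N I \<inter> I" "core E M N I \<subseteq> core E M N J"
    using step.IH[OF step(4)] by auto
  have "core E M N I \<inter> K = core E M N I \<inter> (core E M N J \<inter> K)" using IH(3) by auto
  also have "\<dots> = core E M N I \<inter> J" unfolding *(2) using IH(3) by auto
  finally have eq: "core E M N I \<inter> K = core E M N I \<inter> I" unfolding IH(2) .
  show ?case by (rule conjI[OF order_trans[OF IH(1) *(1)] conjI[OF eq order_trans[OF IH(3) *(3)]]])
qed

text \<open>
  Elements are spanned one after the other whenever possible. The sets \<open>I n\<close> need not converge, but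
  no augmenting path ever meets the region reached from the unspannable elements, so on the union of
  these regions they do. Their limit there is a wave with \<open>e\<close> in its span in \<open>M\<close>, whereas in \<open>N\<close> the
  element \<open>e\<close> is not even spanned by the limit together with everything outside the wave.
\<close>

lemma spannable:
  assumes free: "wave_free E M N" and E: "countable E" and e: "e \<in> E"
  shows "\<exists>I. feasible E M N I \<and> e \<in> N I"
proof (rule ccontr)
  assume neg: "\<not> ?thesis"
  let ?S = "(step E M N)\<^sup>*\<^sup>*"
  define f where "f = from_nat_into E"
  have fE: "f n \<in> E" for n unfolding f_def by (rule from_nat_into) (use e in blast)
  have f_surj: "\<exists>n. f n = x" if "x \<in> E" for x
    using from_nat_into_surj[OF E that] unfolding f_def by blast
  have f0: "feasible E M N {}" using free unfolding feasible_def by simp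
  \<comment> \<open>The conjunct about index zero makes the dependent choice start at the empty
    set.\<close>
  have "\<exists>J. (feasible E M N J \<and> (Suc n = 0 \<longrightarrow> J = {})) \<and> ?S I J \<and> (f n \<in> N J \<or> f n \<in> unspannable E M N I)"
    if "feasible E M N I \<and> (n = 0 \<longrightarrow> I = {})" for I n
  proof (cases "f n \<in> unspannable E M N I")
    case False
    then obtain J where "?S I J" "f n \<in> N J" using fE unfolding unspannable_def by blast
    then show ?thesis using feasible_steps that by blast
  qed (use that in blast)
  then have "\<exists>I. \<forall>n. (feasible E M N (I n) \<and> (n = 0 \<longrightarrow> I n = {})) \<and>
      ?S (I n) (I (Suc n)) \<and> (f n \<in> N (I (Suc n)) \<or> f n \<in> unspannable E M N (I n))"
    using f0 by (intro dependent_nat_choice) auto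
  then obtain I where I: "\<And>n. feasible E M N (I n)" and I0: "I 0 = {}"
    and S: "\<And>n. ?S (I n) (I (Suc n))"
    and sp: "\<And>n. f n \<in> N (I (Suc n)) \<or> f n \<in> unspannable E M N (I n)" by blast
  have steps: "?S (I i) (I j)" if "i \<le> j" for i j
    using that
  proof (induction rule: dec_induct)
    case (step n)
    then show ?case using S[of n] by simp
  qed simp
  define R where "R n = core E M N (I n)" for n
  define K where "K n = R n \<inter> I n" for n
  have mono: "N (I i) \<subseteq> N (I j)" "R i \<inter> I j = K i" "R i \<subseteq> R j" if "i \<le> j" for i j
    using steps_mono[OF steps[OF that] I] unfolding R_def K_def by auto
  have Kmono: "K i \<subseteq> K j" if "i \<le> j" for i j
    using mono[OF that] unfolding K_def by blast
  define R\<^sub>\<omega> where "R\<^sub>\<omega> = (\<Union>n. R n)"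
  define K\<^sub>\<omega> where "K\<^sub>\<omega> = (\<Union>n. K n)"
  have RE: "R\<^sub>\<omega> \<subseteq> E" unfolding R\<^sub>\<omega>_def R_def using core_subset[OF I] by blast
  have KR: "K\<^sub>\<omega> \<subseteq> R\<^sub>\<omega>" unfolding R\<^sub>\<omega>_def K\<^sub>\<omega>_def K_def by blast
  have out: "E - R\<^sub>\<omega> \<subseteq> (\<Union>n. N (I n))"
  proof
    fix x assume x: "x \<in> E - R\<^sub>\<omega>"
    then obtain n where n: "f n = x" using f_surj by blast
    have "x \<notin> unspannable E M N (I n)"
      using x unspannable_core[of E "I n"] unfolding R\<^sub>\<omega>_def R_def by blast
    then show "x \<in> (\<Union>n. N (I n))" using sp[of n] n by blast
  qed
  \<comment> \<open>Finitely many elements are settled at a single stage: those of the limit are in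
    \<open>K n\<close>, the others are spanned from outside the core of that stage.\<close>
  have local: "\<exists>n. Y \<inter> K\<^sub>\<omega> \<subseteq> K n \<and> Y - K\<^sub>\<omega> \<subseteq> N (I n - R n)"
    if Y: "finite Y" "Y \<subseteq> K\<^sub>\<omega> \<union> (E - R\<^sub>\<omega>)" for Y
  proof -
    have fin: "finite (Y \<inter> K\<^sub>\<omega>)" "finite (Y - K\<^sub>\<omega>)" using Y(1) by auto
    have "Y \<inter> K\<^sub>\<omega> \<subseteq> (\<Union>n. K n)" "Y - K\<^sub>\<omega> \<subseteq> (\<Union>n. N (I n))"
      using Y(2) out unfolding K\<^sub>\<omega>_def by auto
    then obtain m n where m: "Y \<inter> K\<^sub>\<omega> \<subseteq> K m" and n: "Y - K\<^sub>\<omega> \<subseteq> N (I n)"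
      using finite_subset_incseq[of K, OF Kmono fin(1)]
        finite_subset_incseq[of "\<lambda>n. N (I n)", OF mono(1) fin(2)] by auto
    have le: "m \<le> max m n" "n \<le> max m n" by auto
    have "Y - K\<^sub>\<omega> \<subseteq> N (I (max m n) - R (max m n))"
    proof
      fix z assume z: "z \<in> Y - K\<^sub>\<omega>"
      then have zz: "z \<in> E" "z \<notin> R (max m n)" using Y unfolding R\<^sub>\<omega>_def by auto
      have "z \<in> N (I (max m n))" using z n mono(1)[OF le(2)] by blast
      then show "z \<in> N (I (max m n) - R (max m n))"
        using outside_core_spanned[OF I zz(1)] zz(2) unfolding R_def by blast
    qed
    then show ?thesis using m Kmono[OF le(1)] by blast
  qed
  have Rsp: "R\<^sub>\<omega> \<subseteq> M K\<^sub>\<omega>"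
  proof
    fix z assume "z \<in> R\<^sub>\<omega>"
    then obtain n where "z \<in> R n" unfolding R\<^sub>\<omega>_def by blast
    then have "z \<in> M (I n \<inter> R n)" using core_spanned[OF I] unfolding R_def by blast
    moreover have "M (I n \<inter> R n) \<subseteq> M K\<^sub>\<omega>" unfolding K\<^sub>\<omega>_def K_def by (rule M.mono) blast
    ultimately show "z \<in> M K\<^sub>\<omega>" by blast
  qed
  have KM: "cindep M K\<^sub>\<omega>"
    unfolding K\<^sub>\<omega>_def
  proof (rule M.cindep_Union_chain)
    fix A B assume "A \<in> range K" "B \<in> range K"
    then obtain i j where "A = K i" "B = K j" by blast
    then show "A \<subseteq> B \<or> B \<subseteq> A" using Kmono[of i j] Kmono[of j i] by (cases "i \<le> j") auto
  next
    fix A assume "A \<in> range K"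
    then obtain n where "A = K n" by blast
    then show "cindep M A" using I[of n] M.cindep_subset[of "I n" A] unfolding feasible_def K_def by blast
  qed
  \<comment> \<open>A dependence uses finitely many elements, so by \<open>local\<close> it would
    already contradict the independence of some \<open>I n\<close>.\<close>
  have KN: "cindep (contr N (E - R\<^sub>\<omega>)) K\<^sub>\<omega>"
    unfolding cindep_def contr_def
  proof (intro ballI notI)
    fix b assume b: "b \<in> K\<^sub>\<omega>" "b \<in> N (K\<^sub>\<omega> - {b} \<union> (E - R\<^sub>\<omega>))"
    obtain Y where Y: "finite Y" "Y \<subseteq> K\<^sub>\<omega> - {b} \<union> (E - R\<^sub>\<omega>)" "b \<in> N Y" using N.finitary[OF b(2)] by blast
    obtain n where n: "insert b Y \<inter> K\<^sub>\<omega> \<subseteq> K n" "insert b Y - K\<^sub>\<omega> \<subseteq> N (I n - R n)"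
      using local[of "insert b Y"] Y b by blast
    have bn: "b \<in> R n" "b \<in> I n" using n b unfolding K_def by auto
    have "Y \<inter> K\<^sub>\<omega> \<subseteq> I n - {b}" using n Y KR b unfolding K_def by blast
    then have "Y \<inter> K\<^sub>\<omega> \<subseteq> N (I n - {b})" using N.ext[of "I n - {b}"] by blast
    moreover have "N (I n - R n) \<subseteq> N (I n - {b})" using bn by (intro N.mono) blast
    ultimately have "Y \<subseteq> N (I n - {b})" using n by blast
    then have "N Y \<subseteq> N (I n - {b})" by (rule N.cl_least)
    then have "b \<in> N (I n - {b})" using Y by blast
    then show False using I[of n] bn unfolding feasible_def cindep_def by blast
  qed
  have "wave E M N K\<^sub>\<omega>" by (rule waveI[OF KR RE Rsp KM KN])
  then have "K\<^sub>\<omega> = {}" using free unfolding wave_free_def by blast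
  then have R0: "R\<^sub>\<omega> \<subseteq> M {}" using Rsp by simp
  have "e \<in> unspannable E M N {}"
    using neg e feasible_steps[OF _ f0] unfolding unspannable_def by blast
  then have "e \<in> R\<^sub>\<omega>" using unspannable_core[of E "{}"] I0 unfolding R\<^sub>\<omega>_def R_def by (metis UN_I UNIV_I subsetD)
  then have "e \<in> N (E - M {})" using R0 e free unfolding wave_free_def by blast
  moreover have "N (E - M {}) \<subseteq> N (E - R\<^sub>\<omega>)" using R0 by (intro N.mono) blast
  ultimately have "e \<in> N (E - R\<^sub>\<omega>)" by blast
  \<comment> \<open>Finitely many elements outside \<open>R\<^sub>\<omega>\<close> are spanned at a
    common stage, which would span \<open>e\<close> as well.\<close>
  from N.finitary[OF this] obtain Y where Y: "finite Y" "Y \<subseteq> E - R\<^sub>\<omega>" "e \<in> N Y" by blast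
  have "Y \<subseteq> (\<Union>n. N (I n))" using Y(2) out by (rule order_trans)
  then obtain n where "Y \<subseteq> N (I n)"
    using finite_subset_incseq[of "\<lambda>n. N (I n)", OF mono(1) Y(1)] by auto
  then have "N Y \<subseteq> N (I n)" by (rule N.cl_least)
  then show False using Y neg I by blast
qed

text \<open>The set from \<open>spannable\<close> need not contain earlier choices, so it is applied
  over the contraction by the current set. The chosen sets then increase, and finitarity keeps their
  union independent.\<close>

lemma spanning_common_indep:
  assumes free: "wave_free E M N" and E: "countable E"
  obtains J where "J \<subseteq> E" "cindep M J" "cindep N J" "E \<subseteq> N J"
proof (cases "E = {}")
  case True
  then show thesis using that[of "{}"] by simp
next
  case False
  define f where "f = from_nat_into E"
  have fE: "f n \<in> E" for n unfolding f_def by (rule from_nat_into[OF False])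
  have f_surj: "\<exists>n. f n = x" if "x \<in> E" for x
    using from_nat_into_surj[OF E that] unfolding f_def by blast
  have f0: "feasible E M N {}" using free unfolding feasible_def by simp
  have "\<exists>J. feasible E M N J \<and> I \<subseteq> J \<and> f n \<in> N J" if I: "feasible E M N I" for I n
  proof -
    interpret P: finitary_pair "contr M I" "contr N I" by (rule finitary_pair_contr)
    have Ii: "I \<subseteq> E" "cindep M I" "cindep N I" "wave_free E (contr M I) (contr N I)"
      using I unfolding feasible_def by auto
    obtain J where J: "feasible E (contr M I) (contr N I) J" "f n \<in> contr N I J"
      using P.spannable[OF Ii(4) E fE] by blast
    have "cindep M (I \<union> J)" "cindep N (I \<union> J)"
      using J(1) M.cindep_Un[OF Ii(2) M.ext] N.cindep_Un[OF Ii(3) N.ext] unfolding feasible_def by auto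
    then have "feasible E M N (I \<union> J)" using J(1) Ii(1) unfolding feasible_def by simp
    moreover have "f n \<in> N (I \<union> J)" using J(2) unfolding contr_def by (simp add: Un_commute)
    ultimately show ?thesis by blast
  qed
  then have "\<exists>I. \<forall>n. feasible E M N (I n) \<and> I n \<subseteq> I (Suc n) \<and> f n \<in> N (I (Suc n))"
    using f0 by (intro dependent_nat_choice) auto
  then obtain I where I: "\<And>n. feasible E M N (I n)" "\<And>n. I n \<subseteq> I (Suc n)" "\<And>n. f n \<in> N (I (Suc n))"
    by blast
  have mono: "I i \<subseteq> I j" if "i \<le> j" for i j using lift_Suc_mono_le[of I] I(2) that by blast
  let ?J = "\<Union>(range I)"
  have lin: "A \<subseteq> B \<or> B \<subseteq> A" if "A \<in> range I" "B \<in> range I" for A B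
    using that mono by (metis imageE linear)
  have "cindep M ?J" by (rule M.cindep_Union_chain[OF lin]) (use I(1) in \<open>auto simp: feasible_def\<close>)
  moreover have "cindep N ?J" by (rule N.cindep_Union_chain[OF lin]) (use I(1) in \<open>auto simp: feasible_def\<close>)
  moreover have "E \<subseteq> N ?J"
  proof
    fix x assume "x \<in> E"
    then obtain n where "f n = x" using f_surj by blast
    then have "x \<in> N (I (Suc n))" using I(3) by blast
    moreover have "N (I (Suc n)) \<subseteq> N ?J" by (rule N.mono) blast
    ultimately show "x \<in> N ?J" by blast
  qed
  moreover have "?J \<subseteq> E" using I(1) unfolding feasible_def by blast
  ultimately show thesis using that[of ?J] by blast
qed

text \<open>The span of a maximal wave becomes the \<open>M\<close>-side. Deletion in
  \<open>N\<close> is restriction of the ground set to \<open>E'\<close>; a nonempty wave of the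
  remaining pair would join \<open>B\<close> to form a wave beyond \<open>M B\<close>.\<close>

theorem countable_split_solution:
  assumes E: "countable E"
  shows "split_solution E M N"
proof -
  obtain B where B: "maximal_wave E M N B" using maximal_wave_exists by blast
  have w: "wave E M N B" and max: "\<And>C. wave E M N C \<Longrightarrow> C \<subseteq> M B"
    using B unfolding maximal_wave_def by auto
  have Bw: "B \<subseteq> E" "cindep M B" "cindep (contr N (E - M B)) B" using w unfolding wave_def by auto
  define E' where "E' = E - M B"
  interpret P: finitary_pair "contr M B" "contr N {}" by (rule finitary_pair_contr)
  have free: "wave_free E' (contr M B) N"
    unfolding wave_free_def
  proof (intro conjI allI impI)
    show "E' \<inter> contr M B {} \<subseteq> N (E' - contr M B {})" unfolding E'_def contr_def by auto
    fix C assume C: "wave E' (contr M B) N C"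
    have MBC: "M B \<subseteq> M (B \<union> C)" by (rule M.mono) blast
    have eq: "E' - contr M B C = E - M (B \<union> C)"
      using MBC unfolding E'_def contr_def by (auto simp: Un_commute)
    have Cw: "C \<subseteq> E'" "cindep (contr M B) C" "cindep (contr N (E - M (B \<union> C))) C"
      using C unfolding wave_def eq by auto
    interpret Q: finitary_pair "contr M {}" "contr N (E - M (B \<union> C))" by (rule finitary_pair_contr)
    have "E - M (B \<union> C) \<union> (E - M B) = E - M B" using MBC by blast
    then have "cindep (contr (contr N (E - M (B \<union> C))) (E - M B)) B" using Bw by simp
    moreover have "C \<subseteq> contr N (E - M (B \<union> C)) (E - M B)"
      using Cw(1) Q.N.ext[of "E - M B"] unfolding E'_def by blast
    ultimately have "cindep (contr N (E - M (B \<union> C))) (C \<union> B)" using Q.N.cindep_Un[OF Cw(3)] by blast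
    moreover have "cindep M (B \<union> C)" by (rule M.cindep_Un[OF Bw(2) M.ext Cw(2)])
    ultimately have "wave E M N (B \<union> C)"
      using Bw Cw unfolding wave_def E'_def by (auto simp: Un_commute)
    then have "C \<subseteq> M B" using max by blast
    then show "C = {}" using Cw unfolding E'_def by blast
  qed
  have "countable E'" unfolding E'_def using E by blast
  then obtain J where J: "J \<subseteq> E'" "cindep (contr M B) J" "cindep N J" "E' \<subseteq> N J"
    using P.spanning_common_indep[of E'] free by auto
  have "cindep (contr M (E \<inter> M B)) J" by (rule M.cindep_contr_mono[OF J(2)]) blast
  moreover have "E - E \<inter> M B = E'" unfolding E'_def by blast
  ultimately show ?thesis
    using J Bw M.ext[of B] unfolding E'_def
    by (intro split_solutionI[of E "E \<inter> M B" "E - M B" B M N J]) auto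
qed

end

section \<open>A finitary and a cofinitary matroid\<close>

definition partitionable where
  "partitionable M P X \<longleftrightarrow> (\<exists>A\<subseteq>X. cindep M A \<and> cindep P (X - A))"

lemma (in finitary_closure) cindep_finite_subsets:
  assumes "\<And>Y. finite Y \<Longrightarrow> Y \<subseteq> X \<Longrightarrow> cindep cl Y"
  shows "cindep cl X"
  unfolding cindep_def
proof (intro ballI notI)
  fix x assume x: "x \<in> X" "x \<in> cl (X - {x})"
  obtain Y where Y: "finite Y" "Y \<subseteq> X - {x}" "x \<in> cl Y" using finitary[OF x(2)] by blast
  have "cindep cl (insert x Y)" by (rule assms) (use x Y in auto)
  moreover have "insert x Y - {x} = Y" using Y by blast
  ultimately show False using Y unfolding cindep_def by force
qed

context finitary_pair
begin

lemma partitionable_subset: "partitionable M N X \<Longrightarrow> Y \<subseteq> X \<Longrightarrow> partitionable M N Y"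
proof -
  assume "partitionable M N X" "Y \<subseteq> X"
  then obtain A where A: "cindep M A" "cindep N (X - A)" "Y \<subseteq> X" unfolding partitionable_def by blast
  have "cindep M (A \<inter> Y)" by (rule M.cindep_subset[OF A(1)]) blast
  moreover have "cindep N (Y - A \<inter> Y)" by (rule N.cindep_subset[OF A(2)]) (use A in blast)
  ultimately show ?thesis unfolding partitionable_def by blast
qed

text \<open>Compactness: take \<open>A\<close> maximal such that every finite \<open>F \<subseteq> X\<close> has a partition respecting \<open>A\<close>.\<close>

lemma partitionable_finite_subsets:
  assumes fin: "\<And>F. finite F \<Longrightarrow> F \<subseteq> X \<Longrightarrow> partitionable M N F"
  shows "partitionable M N X"
proof -
  \<comment> \<open>\<open>B\<close> is the \<open>M\<close>-part of a partition of
    \<open>F\<close>, and \<open>A\<close> holds the elements already committed to the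
    \<open>M\<close>-part.\<close>
  define good where "good A F B \<longleftrightarrow> B \<subseteq> F \<and> F \<inter> A \<subseteq> B \<and> cindep M B \<and> cindep N (F - B)" for A F B
  have good_sub: "good A G (B \<inter> G)" if "good A' F B" "G \<subseteq> F" "A \<inter> G \<subseteq> B" for A A' F G B
    using that M.cindep_subset[of B "B \<inter> G"] N.cindep_subset[of "F - B" "G - B \<inter> G"]
    unfolding good_def by blast
  define S where "S = {A. A \<subseteq> X \<and> (\<forall>F\<subseteq>X. finite F \<longrightarrow> (\<exists>B. good A F B))}"
  have "\<exists>A\<in>S. \<forall>Y\<in>S. A \<subseteq> Y \<longrightarrow> Y = A"
  proof (rule subset_Zorn_nonempty)
    have "\<exists>B. good {} F B" if "F \<subseteq> X" "finite F" for F
      using fin[OF that(2,1)] unfolding partitionable_def good_def by auto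
    then have "{} \<in> S" unfolding S_def by simp
    then show "S \<noteq> {}" by blast
  next
    fix \<C> assume ne: "\<C> \<noteq> {}" and ch: "subset.chain S \<C>"
    then have "\<C> \<subseteq> S" unfolding subset.chain_def by blast
    then have sub: "A \<subseteq> X" "\<And>F. F \<subseteq> X \<Longrightarrow> finite F \<Longrightarrow> \<exists>B. good A F B" if "A \<in> \<C>" for A
      using that unfolding S_def by auto
    have "\<exists>B. good (\<Union>\<C>) F B" if F: "F \<subseteq> X" "finite F" for F
    proof -
      have "finite (F \<inter> \<Union>\<C>)" "F \<inter> \<Union>\<C> \<subseteq> \<Union>\<C>" using F by auto
      then obtain A where A: "A \<in> \<C>" "F \<inter> \<Union>\<C> \<subseteq> A"
        using finite_subset_Union_chain[OF _ _ ne ch] by metis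
      then obtain B where "good A F B" using sub(2) F by blast
      then have "good (\<Union>\<C>) F B" using A unfolding good_def by blast
      then show ?thesis by blast
    qed
    moreover have "\<Union>\<C> \<subseteq> X" using sub(1) by blast
    ultimately show "\<Union>\<C> \<in> S" unfolding S_def by simp
  qed
  then obtain A where A: "A \<subseteq> X" "\<And>F. F \<subseteq> X \<Longrightarrow> finite F \<Longrightarrow> \<exists>B. good A F B"
    and max: "\<And>Y. Y \<in> S \<Longrightarrow> A \<subseteq> Y \<Longrightarrow> Y = A" unfolding S_def by auto
  have "cindep M A"
  proof (rule M.cindep_finite_subsets)
    fix Y assume Y: "finite Y" "Y \<subseteq> A"
    then obtain B where B: "good A Y B" using A by (meson subset_trans)
    then have "B = Y" using Y unfolding good_def by blast
    then show "cindep M Y" using B unfolding good_def by blast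
  qed
  moreover have "cindep N (X - A)"
  proof (rule N.cindep_finite_subsets)
    fix G assume G: "finite G" "G \<subseteq> X - A"
    have "\<exists>F. F \<subseteq> X \<and> finite F \<and> (\<forall>B. \<not> good (insert x A) F B)" if x: "x \<in> G" for x
    proof (rule ccontr)
      assume "\<not> ?thesis"
      then have "insert x A \<in> S" using A(1) G x unfolding S_def by auto
      then have "insert x A = A" by (rule max) blast
      then show False using x G by blast
    qed
    then obtain F where F: "\<And>x. x \<in> G \<Longrightarrow> F x \<subseteq> X \<and> finite (F x) \<and> (\<forall>B. \<not> good (insert x A) (F x) B)"
      by metis
    \<comment> \<open>A partition of \<open>?F\<close> respecting \<open>A\<close> puts no
      \<open>x\<close> of \<open>G\<close> into its \<open>M\<close>-part, since its trace on
      \<open>F x\<close> would respect \<open>insert x A\<close>.\<close>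
    let ?F = "G \<union> (\<Union>x\<in>G. F x)"
    have "?F \<subseteq> X" "finite ?F" using F G by auto
    then obtain B where B: "good A ?F B" using A(2) by blast
    have "x \<notin> B" if x: "x \<in> G" for x
    proof
      assume xB: "x \<in> B"
      have "F x \<subseteq> ?F" using x by blast
      moreover have "insert x A \<inter> F x \<subseteq> B" using B xB x unfolding good_def by blast
      ultimately have "good (insert x A) (F x) (B \<inter> F x)" by (rule good_sub[OF B])
      then show False using F[OF x] by blast
    qed
    then have "G \<subseteq> ?F - B" by blast
    then show "cindep N G" using B N.cindep_subset[of "?F - B" G] unfolding good_def by blast
  qed
  ultimately show ?thesis using A(1) unfolding partitionable_def by blast
qed

lemma maximal_partitionable:
  obtains X where "X \<subseteq> E" "partitionable M N X"
    "\<And>Y. X \<subseteq> Y \<Longrightarrow> Y \<subseteq> E \<Longrightarrow> partitionable M N Y \<Longrightarrow> Y = X"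
proof -
  let ?S = "{X. X \<subseteq> E \<and> partitionable M N X}"
  have "\<exists>X\<in>?S. \<forall>Y\<in>?S. X \<subseteq> Y \<longrightarrow> Y = X"
  proof (rule subset_Zorn_nonempty)
    have "partitionable M N {}" unfolding partitionable_def by simp
    then show "?S \<noteq> {}" by blast
  next
    fix \<C> assume ne: "\<C> \<noteq> {}" and ch: "subset.chain ?S \<C>"
    then have sub: "\<C> \<subseteq> ?S" unfolding subset.chain_def by blast
    have "partitionable M N (\<Union>\<C>)"
    proof (rule partitionable_finite_subsets)
      fix F assume F: "finite F" "F \<subseteq> \<Union>\<C>"
      then obtain A where "A \<in> \<C>" "F \<subseteq> A" using finite_subset_Union_chain[OF F ne ch] by blast
      moreover from this have "partitionable M N A" using sub by blast
      ultimately show "partitionable M N F" using partitionable_subset by blast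
    qed
    moreover have "\<Union>\<C> \<subseteq> E" using sub by auto
    ultimately show "\<Union>\<C> \<in> ?S" by simp
  qed
  then obtain X where "X \<in> ?S" "\<forall>Y\<in>?S. X \<subseteq> Y \<longrightarrow> Y = X" by blast
  then show thesis using that[of X] by simp
qed

end

text \<open>
  Choose a set that is the union of an \<open>\<M>\<close>-independent set \<open>I\<close> and a \<open>\<P>\<close>-base \<open>E - B\<close>, maximal with
  this property. An augmenting path for \<open>I\<close> with respect to \<open>\<M>\<close> and the dual of \<open>\<P>\<close> would enlarge it.
\<close>

lemma finitary_cofinitary_split_solution:
  assumes M: "matroid E \<M>" "finitary_closure (mcl E \<M>)" and P: "matroid E \<P>" "finitary_closure (mcl E \<P>)"
  shows "split_solution E (mcl E \<M>) (mcl E (dual E \<P>))"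
proof -
  interpret MM: matroid E \<M> by fact
  interpret PP: matroid E \<P> by fact
  interpret DD: matroid E "dual E \<P>" by (rule PP.matroid_dual)
  define M where "M = mcl E \<M>"
  define P where "P = mcl E \<P>"
  define N where "N = mcl E (dual E \<P>)"
  interpret F: finitary_pair M P unfolding M_def P_def by (intro finitary_pair.intro M P)
  interpret closure_pair M N
    unfolding M_def N_def by (intro closure_pair.intro MM.closure_matroid_mcl DD.closure_matroid_mcl)
  obtain X where X: "X \<subseteq> E" "partitionable M P X"
    and max: "\<And>Y. X \<subseteq> Y \<Longrightarrow> Y \<subseteq> E \<Longrightarrow> partitionable M P Y \<Longrightarrow> Y = X"
    by (rule F.maximal_partitionable[of E]) blast
  obtain A where A: "A \<subseteq> X" "cindep M A" "cindep P (X - A)" using X(2) unfolding partitionable_def by blast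
  have "X - A \<subseteq> E" using X by blast
  from F.N.base[OF A(3) this]
  obtain J where J: "X - A \<subseteq> J" "J \<subseteq> E" "cindep P J" "E \<subseteq> P J" by auto
  define I where "I = A - J"
  define B where "B = E - J"
  have I: "cindep M I" unfolding I_def by (rule F.M.cindep_subset[OF A(2)]) blast
  have "(I \<union> J) - I = J" unfolding I_def by blast
  then have "partitionable M P (I \<union> J)" using I J(3) unfolding partitionable_def by (intro exI[of _ I]) auto
  \<comment> \<open>Enlarging the \<open>P\<close>-part to a base loses nothing of \<open>X\<close>,
    so by maximality it gains nothing either.\<close>
  then have XIJ: "I \<union> J = X" using J(1,2) A(1) X(1) unfolding I_def by (intro max) auto
  have IB: "I \<subseteq> B" "I \<subseteq> E" using A X unfolding I_def B_def by auto
  have "J \<in> bases \<P>" using J PP.bases_mcl_iff PP.cindep_mcl unfolding P_def by blast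
  then have "B \<in> bases (dual E \<P>)" unfolding B_def PP.bases_dual by blast
  then have B: "cindep N B" "E \<subseteq> N B"
    using DD.bases_mcl_iff DD.cindep_mcl[of B] unfolding N_def B_def by auto
  have IN: "cindep N I" by (rule N.cindep_subset[OF B(1) IB(1)])
  show ?thesis
    unfolding M_def[symmetric] N_def[symmetric]
  proof (rule no_augmenting_path_split_solution[OF IB(2) I IN], rule notI)
    fix x y k assume p: "augmenting_path M N E I x y k"
    let ?I = "flip I x y k"
    have x0: "x 0 \<in> E" "x 0 \<notin> N I" using p unfolding augmenting_path_def by auto
    let ?C = "{z \<in> B. x 0 \<notin> N (B - {z})}"
    have "x 0 \<in> N ?C" by (rule N.fundamental[OF B(1)]) (use B x0 in blast)
    then have "\<not> ?C \<subseteq> I" using x0 N.mono[of ?C I] by blast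
    \<comment> \<open>\<open>b\<close> can leave the base \<open>B\<close> of \<open>N\<close> when
      \<open>x 0\<close> enters. It lies in neither \<open>I\<close> nor \<open>J\<close> and is the
      element that the enlarged union gains.\<close>
    then obtain b where b: "b \<in> B" "b \<notin> I" "x 0 \<notin> N (B - {b})" by blast
    define B' where "B' = ?I \<union> (B - I - {b})"
    have IE: "?I \<subseteq> E" by (rule flip_subset[OF IB(2) p])
    have "insert (x 0) I \<subseteq> N ?I" unfolding flip_N(2)[OF IN p] by (rule N.ext)
    also have "N ?I \<subseteq> N B'" unfolding B'_def by (rule N.mono) blast
    finally have "insert (x 0) (B - {b}) \<subseteq> N B'" using N.ext[of B'] unfolding B'_def by blast
    then have "N (insert (x 0) (B - {b})) \<subseteq> N B'" by (rule N.cl_least)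
    moreover have "N (insert (x 0) (B - {b})) = N B" by (rule N.swap_cl[OF b(1) _ b(3)]) (use B x0 in blast)
    ultimately have sp: "E \<subseteq> N B'" using B by blast
    have B'E: "B' \<subseteq> E" using IE unfolding B'_def B_def by blast
    have "cindep P (E - B')"
      unfolding cindep_def P_def
    proof
      fix z assume z: "z \<in> E - B'"
      then show "z \<notin> mcl E \<P> (E - B' - {z})" using PP.mcl_dual_iff[OF B'E z] sp unfolding N_def by blast
    qed
    moreover have "?I \<union> (E - B') - ?I = E - B'" unfolding B'_def by blast
    ultimately have "partitionable M P (?I \<union> (E - B'))"
      using flip_M(1)[OF I p] unfolding partitionable_def by (intro exI[of _ ?I]) auto
    moreover have "X \<subseteq> ?I \<union> (E - B')" unfolding XIJ[symmetric] B'_def B_def using IB J unfolding B_def by blast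
    ultimately have "?I \<union> (E - B') = X" using IE by (intro max) auto
    moreover have "b \<in> ?I \<union> (E - B')" using b unfolding B'_def B_def by blast
    ultimately show False using b unfolding XIJ[symmetric] B_def by blast
  qed
qed

section \<open>The intersection property\<close>

theorem theorem1p4:
  fixes E :: "'a set" and \<M> \<N> :: "'a set set"
  assumes "matroid E \<M>" and "matroid E \<N>"
    and "countable E"
    and "nearly_finitary E \<M> \<or> nearly_cofinitary E \<M>"
    and "nearly_finitary E \<N> \<or> nearly_cofinitary E \<N>"
  shows "intersection_property E \<M> \<N>"
proof -
  define fin where "fin = finitarization E"
  define cofin where "cofin \<I> = dual E (finitarization E (dual E \<I>))" for \<I>
  have m: "matroid E (fin \<I>)" "matroid E (dual E \<I>)" "finitary_closure (mcl E (fin \<I>))"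
    if "matroid E \<I>" for \<I>
    unfolding fin_def using matroid.matroid_finitarization[OF that] matroid.matroid_dual[OF that]
      matroid.finitary_closure_finitarization[OF that] .
  have cofin: "cofin \<I> = dual E (fin (dual E \<I>))" for \<I> unfolding cofin_def fin_def ..
  have ff: "split_solution E (mcl E (fin \<I>)) (mcl E (fin \<J>))" if "matroid E \<I>" "matroid E \<J>" for \<I> \<J>
    by (intro finitary_pair.countable_split_solution finitary_pair.intro m that \<open>countable E\<close>)
  have fc: "split_solution E (mcl E (fin \<I>)) (mcl E (cofin \<J>))" if "matroid E \<I>" "matroid E \<J>" for \<I> \<J>
    unfolding cofin by (intro finitary_cofinitary_split_solution m that)
  have cc: "split_solution E (mcl E (cofin \<I>)) (mcl E (cofin \<J>))" if "matroid E \<I>" "matroid E \<J>" for \<I> \<J>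
    unfolding cofin by (intro split_solution_dual ff m that)
  have close: "\<exists>\<I>'\<in>{fin \<I>, cofin \<I>}. matroid E \<I>' \<and> finitely_close E (mcl E \<I>') (mcl E \<I>)"
    if "matroid E \<I>" "nearly_finitary E \<I> \<or> nearly_cofinitary E \<I>" for \<I>
    using that matroid.nearly_finitary_finitely_close[of E \<I>] matroid.nearly_cofinitary_finitely_close[of E \<I>]
      m[OF that(1)] m(2)[OF m(1)[OF m(2)[OF that(1)]]]
    unfolding cofin fin_def by blast
  obtain \<M>' where M': "\<M>' \<in> {fin \<M>, cofin \<M>}" "matroid E \<M>'" "finitely_close E (mcl E \<M>') (mcl E \<M>)"
    using close assms by blast
  obtain \<N>' where N': "\<N>' \<in> {fin \<N>, cofin \<N>}" "matroid E \<N>'" "finitely_close E (mcl E \<N>') (mcl E \<N>)"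
    using close assms by blast
  have "split_solution E (mcl E \<M>') (mcl E \<N>')"
    using M'(1) N'(1) assms(1,2) ff fc cc split_solution_sym[OF fc] by auto
  then have "split_solution E (mcl E \<M>) (mcl E \<N>)"
    by (intro finitely_close_split_solution[OF _ _ M'(3) N'(3)] closure_pair.intro
        matroid.closure_matroid_mcl M' N' assms)
  then show ?thesis by (rule intersection_propertyI[OF assms(1,2)])
qed

end
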